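(* Let $\Delta$ be a pure simplicial forest with $\dim(\Delta)>0$. Then for all integers $k$ with $1\le k<\nu_0(\Delta)$, the ideal $I(\Delta)^{[k]}$ is not linearly related and, hence, does not have a linear resolution.
   Context: A simplicial complex $\Delta$ on a finite vertex set is a non-empty collection of subsets (faces) closed under taking subsets; its facets are the inclusion-maximal faces, and $\mathcal F(\Delta)$ is the set of facets. The dimension of a face $F$ is $|F|-1$, $\dim\Delta$ is the maximum dimension of a face, and $\Delta$ is pure if all facets have the same dimension. A subcollection of $\Delta$ is a simplicial complex $\Delta'$ with $\mathcal F(\Delta')\subseteq\mathcal F(\Delta)$. A facet $F$ of $\Delta$ is a leaf if either $F$ is the only facet of $\Delta$ or there is a facet $G\neq F$ of $\Delta$ with $H\cap F\subseteq G\cap F$ for all facets $H\ne F$ of $\Delta$. A connected simplicial complex is a (simplicial) tree if every nonempty subcollection of it has a leaf; a simplicial forest is a simplicial complex each of whose connected components is a tree. A matching of $\Delta$ is a set of pairwise disjoint facets. Two facets $F,G$ form a gap in $\Delta$ if $F\cap G=\emptyset$ and the only facets of $\Delta$ contained in $F\cup G$ are $F$ and $G$. A matching $M$ is a restricted matching if some facet in $M$ forms a gap with every other facet in $M$; $\nu_0(\Delta)$ is the maximum size of a restricted matching. Let $S$ be the polynomial ring over a field $K$ with variables $x_v$ indexed by the vertices. The facet ideal $I(\Delta)\subseteq S$ is generated by the monomials $\prod_{v\in F}x_v$, $F\in\mathcal F(\Delta)$. For a squarefree monomial ideal $I$, $I^{[k]}$ is the ideal generated by the squarefree monomials among the minimal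 monomial generators of $I^k$. Let $\beta_{i,j}(I)$ denote the graded Betti numbers of the minimal graded free resolution of $I$ as an $S$-module ($\beta_{0,j}(I)$ counts minimal generators of degree $j$). A homogeneous ideal $I$ generated in a single degree $e$ is linearly related if $\beta_{1,j}(I)=0$ for all $j\ne e+1$, and has a linear resolution if $\beta_{i,j}(I)=0$ for all $i\ge0$ and $j\ne i+e$. *)

theory Defs
  imports
    "HOL-Library.Poly_Mapping"
    "HOL-Library.Disjoint_Sets"
    "Jordan_Normal_Form.Matrix_Kernel"
begin

section \<open>Simplicial complexes\<close>

text \<open>The finite type \<^typ>\<open>'v\<close> is the vertex set. As usual, a vertex \<open>v\<close> need not be a face \<open>{v}\<close>.\<close>

definition simplicial_complex :: "'v::finite set set \<Rightarrow> bool" where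
  "simplicial_complex \<Delta> \<longleftrightarrow> \<Delta> \<noteq> {} \<and> (\<forall>F\<in>\<Delta>. \<forall>G. G \<subseteq> F \<longrightarrow> G \<in> \<Delta>)"

definition facets :: "'v::finite set set \<Rightarrow> 'v set set" where
  "facets \<Delta> = {F\<in>\<Delta>. \<forall>G\<in>\<Delta>. F \<subseteq> G \<longrightarrow> F = G}"

definition face_dim :: "'v::finite set \<Rightarrow> int" where
  "face_dim F = int (card F) - 1"

definition complex_dim :: "'v::finite set set \<Rightarrow> int" where
  "complex_dim \<Delta> = Max (face_dim ` \<Delta>)"

definition pure :: "'v::finite set set \<Rightarrow> bool" where
  "pure \<Delta> \<longleftrightarrow> (\<forall>F\<in>facets \<Delta>. \<forall>G\<in>facets \<Delta>. face_dim F = face_dim G)"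

text \<open>Since a simplicial complex is non-empty as a collection of sets, every subcollection has at
  least one facet; this is what ``non-empty subcollection'' means.\<close>

definition subcollection :: "'v::finite set set \<Rightarrow> 'v set set \<Rightarrow> bool" where
  "subcollection \<Delta>' \<Delta> \<longleftrightarrow> simplicial_complex \<Delta>' \<and> facets \<Delta>' \<subseteq> facets \<Delta>"

definition leaf :: "'v::finite set set \<Rightarrow> 'v set \<Rightarrow> bool" where
  "leaf \<Delta> F \<longleftrightarrow> F \<in> facets \<Delta> \<and>
     (facets \<Delta> = {F} \<or>
      (\<exists>G\<in>facets \<Delta>. G \<noteq> F \<and> (\<forall>H\<in>facets \<Delta>. H \<noteq> F \<longrightarrow> H \<inter> F \<subseteq> G \<inter> F)))"

text \<open>Connected: any two facets are joined by a chain of facets in which consecutive ones meet.\<close>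

definition complex_connected :: "'v::finite set set \<Rightarrow> bool" where
  "complex_connected \<Delta> \<longleftrightarrow>
     (\<forall>F\<in>facets \<Delta>. \<forall>G\<in>facets \<Delta>.
        (F, G) \<in> {(A, B). A \<in> facets \<Delta> \<and> B \<in> facets \<Delta> \<and> A \<inter> B \<noteq> {}}\<^sup>*)"

definition connected_component_of_complex :: "'v::finite set set \<Rightarrow> 'v set set \<Rightarrow> bool" where
  "connected_component_of_complex \<Gamma> \<Delta> \<longleftrightarrow>
     subcollection \<Gamma> \<Delta> \<and> complex_connected \<Gamma> \<and>
     (\<forall>\<Gamma>'. subcollection \<Gamma>' \<Delta> \<and> complex_connected \<Gamma>' \<and> \<Gamma> \<subseteq> \<Gamma>' \<longrightarrow> \<Gamma>' = \<Gamma>)"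

definition simplicial_tree :: "'v::finite set set \<Rightarrow> bool" where
  "simplicial_tree \<Delta> \<longleftrightarrow> simplicial_complex \<Delta> \<and> complex_connected \<Delta> \<and>
     (\<forall>\<Delta>'. subcollection \<Delta>' \<Delta> \<longrightarrow> (\<exists>F. leaf \<Delta>' F))"

definition simplicial_forest :: "'v::finite set set \<Rightarrow> bool" where
  "simplicial_forest \<Delta> \<longleftrightarrow> simplicial_complex \<Delta> \<and>
     (\<forall>\<Gamma>. connected_component_of_complex \<Gamma> \<Delta> \<longrightarrow> simplicial_tree \<Gamma>)"

definition matching :: "'v::finite set set \<Rightarrow> 'v set set \<Rightarrow> bool" where
  "matching \<Delta> M \<longleftrightarrow> M \<subseteq> facets \<Delta> \<and> disjoint M"

definition forms_gap :: "'v::finite set set \<Rightarrow> 'v set \<Rightarrow> 'v set \<Rightarrow> bool" where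
  "forms_gap \<Delta> F G \<longleftrightarrow> F \<inter> G = {} \<and> {H \<in> facets \<Delta>. H \<subseteq> F \<union> G} = {F, G}"

definition restricted_matching :: "'v::finite set set \<Rightarrow> 'v set set \<Rightarrow> bool" where
  "restricted_matching \<Delta> M \<longleftrightarrow> matching \<Delta> M \<and> (\<exists>F\<in>M. \<forall>G\<in>M - {F}. forms_gap \<Delta> F G)"

definition restricted_matching_number :: "'v::finite set set \<Rightarrow> nat" (\<open>\<nu>\<^sub>0\<close>) where
  "\<nu>\<^sub>0 \<Delta> = Max {card M | M. restricted_matching \<Delta> M}"


section \<open>Monomial ideals\<close>

text \<open>\<open>('v, 'k) mpoly\<close> is the polynomial ring \<open>K[x\<^sub>v | v]\<close>: a polynomial maps exponent vectors to
  coefficients, and multiplication is convolution.\<close>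

type_synonym ('v, 'k) mpoly = "('v \<Rightarrow>\<^sub>0 nat) \<Rightarrow>\<^sub>0 'k"

abbreviation ideal_generated :: "'r::comm_ring_1 set \<Rightarrow> 'r set" where
  "ideal_generated \<equiv> Modules.module.span (*)"

text \<open>The span above is the one of the ring as a module over itself:\<close>

lemma module_times: "Modules.module ((*) :: 'r::comm_ring_1 \<Rightarrow> 'r \<Rightarrow> 'r)"
  by unfold_locales (simp_all add: algebra_simps)

primrec ideal_power :: "'r::comm_ring_1 set \<Rightarrow> nat \<Rightarrow> 'r set" where
  "ideal_power I 0 = UNIV"
| "ideal_power I (Suc k) = ideal_generated {a * b | a b. a \<in> I \<and> b \<in> ideal_power I k}"

definition variable :: "'v \<Rightarrow> ('v, 'k::field) mpoly" where
  "variable v = Poly_Mapping.single (Poly_Mapping.single v 1) 1"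

definition monomials :: "('v, 'k::field) mpoly set" where
  "monomials = {Poly_Mapping.single a 1 | a. True}"

definition squarefree_monomial :: "'v::finite set \<Rightarrow> ('v, 'k::field) mpoly" where
  "squarefree_monomial F = (\<Prod>v\<in>F. variable v)"

definition facet_ideal :: "'v::finite set set \<Rightarrow> ('v, 'k::field) mpoly set" where
  "facet_ideal \<Delta> = ideal_generated (squarefree_monomial ` facets \<Delta>)"

definition minimal_monomial_generators :: "('v, 'k::field) mpoly set \<Rightarrow> ('v, 'k) mpoly set" where
  "minimal_monomial_generators I =
     {u \<in> monomials \<inter> I. \<forall>w \<in> monomials \<inter> I. w dvd u \<longrightarrow> w = u}"

definition squarefree_power :: "('v::finite, 'k::field) mpoly set \<Rightarrow> nat \<Rightarrow> ('v, 'k) mpoly set" where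
  "squarefree_power I k =
     ideal_generated {u \<in> minimal_monomial_generators (ideal_power I k).
                        \<exists>F. u = squarefree_monomial F}"


section \<open>Minimal graded free resolutions and graded Betti numbers\<close>

definition exponent_degree :: "('v::finite \<Rightarrow>\<^sub>0 nat) \<Rightarrow> nat" where
  "exponent_degree a = (\<Sum>v\<in>UNIV. Poly_Mapping.lookup a v)"

text \<open>\<open>homogeneous p e\<close> includes the case \<open>p = 0\<close>.\<close>

definition homogeneous :: "('v::finite, 'k::field) mpoly \<Rightarrow> nat \<Rightarrow> bool" where
  "homogeneous p e \<longleftrightarrow> (\<forall>a\<in>Poly_Mapping.keys p. exponent_degree a = e)"

text \<open>
  A resolution \<open>\<dots> \<rightarrow> F\<^sub>1 \<rightarrow> F\<^sub>0 \<rightarrow> I \<rightarrow> 0\<close> of an ideal \<open>I\<close> of the polynomial ring \<open>S\<close> by finitely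
  generated graded free modules is given by matrices \<open>D i\<close> and degrees \<open>d i l\<close>, with
  \<open>F\<^sub>i = \<Oplus>l < dim_col (D i). S(- d i l)\<close>. The matrix \<open>D 0\<close> has one row and describes
  \<open>F\<^sub>0 \<rightarrow> I \<subseteq> S\<close>; the matrix \<open>D (Suc i)\<close> describes \<open>F\<^sub>i\<^sub>+\<^sub>1 \<rightarrow> F\<^sub>i\<close>. The degrees
  are natural numbers because \<open>I\<close> lives in non-negative degrees.
\<close>

definition graded_free_resolution ::
  "('v::finite, 'k::field) mpoly set \<Rightarrow> (nat \<Rightarrow> ('v, 'k) mpoly mat) \<Rightarrow> (nat \<Rightarrow> nat \<Rightarrow> nat) \<Rightarrow> bool" where
  "graded_free_resolution I D d \<longleftrightarrow>
     \<comment> \<open>the matrices are composable\<close>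
     dim_row (D 0) = 1 \<and> (\<forall>i. dim_row (D (Suc i)) = dim_col (D i)) \<and>
     \<comment> \<open>the maps are homogeneous of degree 0\<close>
     (\<forall>l < dim_col (D 0). homogeneous (D 0 $$ (0, l)) (d 0 l)) \<and>
     (\<forall>i. \<forall>m < dim_col (D i). \<forall>l < dim_col (D (Suc i)).
        \<forall>a \<in> Poly_Mapping.keys (D (Suc i) $$ (m, l)). exponent_degree a + d i m = d (Suc i) l) \<and>
     \<comment> \<open>exactness at \<open>I\<close> and at each \<open>F\<^sub>i\<close>\<close>
     {(D 0 *\<^sub>v w) $ 0 | w. w \<in> carrier_vec (dim_col (D 0))} = I \<and>
     (\<forall>i. mat_kernel (D i) = {D (Suc i) *\<^sub>v w | w. w \<in> carrier_vec (dim_col (D (Suc i)))})"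

text \<open>Minimality: \<open>F\<^sub>i\<^sub>+\<^sub>1\<close> is mapped into \<open>\<mm>F\<^sub>i\<close>, where \<open>\<mm>\<close> is the ideal of the variables, that is,
  no matrix entry has a constant term.\<close>

definition minimal_graded_free_resolution ::
  "('v::finite, 'k::field) mpoly set \<Rightarrow> (nat \<Rightarrow> ('v, 'k) mpoly mat) \<Rightarrow> (nat \<Rightarrow> nat \<Rightarrow> nat) \<Rightarrow> bool" where
  "minimal_graded_free_resolution I D d \<longleftrightarrow> graded_free_resolution I D d \<and>
     (\<forall>i. \<forall>m < dim_col (D i). \<forall>l < dim_col (D (Suc i)).
        D (Suc i) $$ (m, l) \<in> ideal_generated (Set.range variable))"

text \<open>A homogeneous ideal has a minimal graded free resolution, unique up to isomorphism of graded
  complexes, so the numbers below do not depend on the choice.\<close>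

definition the_minimal_resolution ::
  "('v::finite, 'k::field) mpoly set \<Rightarrow> (nat \<Rightarrow> ('v, 'k) mpoly mat) \<times> (nat \<Rightarrow> nat \<Rightarrow> nat)" where
  "the_minimal_resolution I = (SOME (D, d). minimal_graded_free_resolution I D d)"

definition graded_betti :: "('v::finite, 'k::field) mpoly set \<Rightarrow> nat \<Rightarrow> nat \<Rightarrow> nat" where
  "graded_betti I i j =
     (case the_minimal_resolution I of (D, d) \<Rightarrow> card {l. l < dim_col (D i) \<and> d i l = j})"

definition generated_in_degree :: "('v::finite, 'k::field) mpoly set \<Rightarrow> nat \<Rightarrow> bool" where
  "generated_in_degree I e \<longleftrightarrow> (\<exists>G. (\<forall>g\<in>G. homogeneous g e) \<and> I = ideal_generated G)"

definition linearly_related :: "('v::finite, 'k::field) mpoly set \<Rightarrow> bool" where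
  "linearly_related I \<longleftrightarrow>
     (\<exists>e. generated_in_degree I e \<and> (\<forall>j. j \<noteq> e + 1 \<longrightarrow> graded_betti I 1 j = 0))"

definition has_linear_resolution :: "('v::finite, 'k::field) mpoly set \<Rightarrow> bool" where
  "has_linear_resolution I \<longleftrightarrow>
     (\<exists>e. generated_in_degree I e \<and> (\<forall>i j. j \<noteq> i + e \<longrightarrow> graded_betti I i j = 0))"

end

theory Submission
  imports Defs "HOL-Library.Function_Algebras"
begin

text \<open>
  Let \<open>d \<ge> 2\<close> be the common size of the facets. The ideal \<open>I(\<Delta>)\<^sup>[\<^sup>k\<^sup>]\<close> is generated by the monomials \<open>x\<^sup>w\<close>, where \<open>w\<close>
  is the union of a matching of \<open>k\<close> facets (\<open>squarefree_power_facet_ideal\<close>), so it lives in degree \<open>k d\<close>.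
  As \<open>k < \<nu>\<^sub>0 \<Delta>\<close>, there is a matching \<open>M\<close> of \<open>k + 1\<close> facets with a member \<open>F\<close> that forms a gap with
  every other one. Let \<open>u\<close> be the union of \<open>M - {F}\<close>, and \<open>v\<close> that of \<open>M - {G}\<close> for another member \<open>G\<close>.

  The combinatorial core is \<open>matching_in_restricted_matching\<close>: a matching of \<open>k\<close> facets inside \<open>\<Union>M\<close> either
  contains \<open>F\<close> or equals \<open>M - {F}\<close>. It comes from counting edges. Between two disjoint matchings of a
  simplicial forest the graph of meeting pairs has no cycles, so it has fewer edges than vertices; but
  facets crossing between members of \<open>M\<close> would, because of the gaps, all have degree at least two.
  Consequently, if \<open>i \<in> F\<close>, then \<open>x\<^sup>u\<close> is the only generator that divides \<open>x\<^sub>i x\<^sup>u\<close>: any other one inside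
  \<open>\<Union>M\<close> contains \<open>F\<close>, which has at least two vertices and is disjoint from \<open>u\<close>.

  Thus \<open>x\<^sup>u\<close> is isolated among the generators dividing \<open>x\<^sup>\<Union>\<^sup>M\<close>: a linear syzygy cannot multiply \<open>x\<^sup>u\<close> by a
  variable from \<open>F\<close>. So linear syzygies do not generate the syzygy between \<open>x\<^sup>u\<close> and \<open>x\<^sup>v\<close>, in which \<open>x\<^sup>u\<close> is
  multiplied by \<open>x\<^sup>F\<close> (\<open>minimal_resolution_nonlinear_syzygy\<close>), and some first syzygy in a minimal
  resolution has degree different from \<open>k d + 1\<close>.

  The Betti numbers refer to a chosen minimal resolution, so one has to exist. For squarefree monomial
  ideals it is constructed in \<open>exists_minimal_resolution_squarefree\<close>, by linear algebra over the field in each of the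
  finitely many squarefree multidegrees.
\<close>


section \<open>Monomials and their exponents\<close>

interpretation ideal: Modules.module "(*) :: 'r::comm_ring_1 \<Rightarrow> 'r \<Rightarrow> 'r"
  by (rule module_times)

definition expo :: "'v::finite set \<Rightarrow> 'v \<Rightarrow>\<^sub>0 nat" where
  "expo F = (\<Sum>v\<in>F. Poly_Mapping.single v 1)"

lemma lookup_expo: "Poly_Mapping.lookup (expo F) v = (if v \<in> F then 1 else 0)"
  by (simp add: expo_def lookup_sum lookup_single when_def)

lemma keys_expo [simp]: "Poly_Mapping.keys (expo F) = F"
  by (auto simp: in_keys_iff lookup_expo split: if_splits)

lemma expo_inject [simp]: "expo F = expo G \<longleftrightarrow> F = G"
  by (metis keys_expo)

lemma expo_empty [simp]: "expo {} = 0"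
  by (simp add: expo_def)

lemma expo_union_disjoint: "A \<inter> B = {} \<Longrightarrow> expo (A \<union> B) = expo A + expo B"
  by (simp add: expo_def sum.union_disjoint)

lemma expo_diff_add: "A \<subseteq> B \<Longrightarrow> expo (B - A) + expo A = expo B"
  by (metis Diff_disjoint Diff_partition add.commute expo_union_disjoint)

lemma exponent_degree_add: "exponent_degree (a + b) = exponent_degree a + exponent_degree b"
  by (simp add: exponent_degree_def lookup_add sum.distrib)

lemma exponent_degree_expo [simp]: "exponent_degree (expo F) = card F"
  by (simp add: exponent_degree_def lookup_expo sum.If_cases)

lemma exponent_degree_eq_0: "exponent_degree a = 0 \<longleftrightarrow> a = 0"
  by (auto simp: exponent_degree_def poly_mapping_eq_iff fun_eq_iff)

lemma exponent_degree_1E: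
  assumes "exponent_degree a = 1"
  obtains v where "a = Poly_Mapping.single v 1"
proof -
  obtain v where v: "Poly_Mapping.lookup a v = 1" "\<And>w. w \<noteq> v \<Longrightarrow> Poly_Mapping.lookup a w = 0"
    using assms sum_eq_1_iff[OF finite, of "Poly_Mapping.lookup a" UNIV] by (auto simp: exponent_degree_def)
  have "a = Poly_Mapping.single v 1"
    by (rule poly_mapping_eqI) (metis v lookup_single_eq lookup_single_not_eq)
  then show ?thesis using that by blast
qed

lemma expo_singleton: "expo {v} = Poly_Mapping.single v 1"
  by (simp add: expo_def)

text \<open>Divisibility by a squarefree monomial only depends on the set of variables that occur; this is what
  later replaces exponents by subsets of the vertex set.\<close>

lemma subset_keys_iff: "A \<subseteq> Poly_Mapping.keys a \<longleftrightarrow> (\<exists>b. a = b + expo A)"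
proof
  assume A: "A \<subseteq> Poly_Mapping.keys a"
  have "a = (a - expo A) + expo A"
  proof (rule poly_mapping_eqI)
    fix v
    have "v \<in> A \<Longrightarrow> Poly_Mapping.lookup a v \<noteq> 0"
      using A by (auto simp: in_keys_iff)
    then show "Poly_Mapping.lookup a v = Poly_Mapping.lookup (a - expo A + expo A) v"
      by (auto simp: lookup_add lookup_minus lookup_expo)
  qed
  then show "\<exists>b. a = b + expo A" ..
next
  assume "\<exists>b. a = b + expo A"
  then show "A \<subseteq> Poly_Mapping.keys a"
    by (auto simp: in_keys_iff lookup_add lookup_expo)
qed

lemma subset_of_expo_eq_add:
  assumes "expo B = c + expo A"
  shows "A \<subseteq> B"
proof -
  have "A \<subseteq> Poly_Mapping.keys (expo B)"
    unfolding subset_keys_iff using assms by blast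
  then show ?thesis by simp
qed

lemma squarefree_monomial_eq:
  "squarefree_monomial F = (Poly_Mapping.single (expo F) 1 :: ('v::finite, 'k::field) mpoly)"
proof (induction F rule: finite_induct[OF finite])
  case 1
  then show ?case by (simp add: squarefree_monomial_def)
next
  case (2 v F)
  then have "squarefree_monomial (insert v F) = variable v * (squarefree_monomial F :: ('v, 'k) mpoly)"
    by (simp add: squarefree_monomial_def)
  also have "\<dots> = Poly_Mapping.single (Poly_Mapping.single v 1 + expo F) 1"
    using 2 by (simp add: variable_def mult_single)
  also have "Poly_Mapping.single v 1 + expo F = expo (insert v F)"
    using 2 by (simp add: expo_def)
  finally show ?case .
qed

lemma poly_eq_sum_single:
  "p = (\<Sum>a\<in>Poly_Mapping.keys p. Poly_Mapping.single a (Poly_Mapping.lookup p a))"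
proof (rule poly_mapping_eqI)
  fix b
  show "Poly_Mapping.lookup p b =
      Poly_Mapping.lookup (\<Sum>a\<in>Poly_Mapping.keys p. Poly_Mapping.single a (Poly_Mapping.lookup p a)) b"
    by (simp add: lookup_sum lookup_single when_def in_keys_iff)
qed

lemma lookup_times:
  fixes p q :: "'a::comm_monoid_add \<Rightarrow>\<^sub>0 'b::comm_semiring_0"
  shows "Poly_Mapping.lookup (p * q) b =
    (\<Sum>a\<in>Poly_Mapping.keys p. \<Sum>c\<in>Poly_Mapping.keys q.
       if a + c = b then Poly_Mapping.lookup p a * Poly_Mapping.lookup q c else 0)"
proof -
  have "p * q = (\<Sum>a\<in>Poly_Mapping.keys p. \<Sum>c\<in>Poly_Mapping.keys q.
      Poly_Mapping.single (a + c) (Poly_Mapping.lookup p a * Poly_Mapping.lookup q c))"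
    by (subst poly_eq_sum_single[of p], subst poly_eq_sum_single[of q])
      (simp add: sum_product mult_single)
  then show ?thesis
    by (simp add: lookup_sum lookup_single when_def)
qed

text \<open>Usually applied for reasons of degree or divisibility: only one pair of exponents can contribute.\<close>

lemma lookup_times_eq_single_term:
  fixes p q :: "'a::cancel_comm_monoid_add \<Rightarrow>\<^sub>0 'b::comm_semiring_0"
  assumes "\<And>a' c'. a' + c' = a + c \<Longrightarrow> a' \<in> Poly_Mapping.keys p \<Longrightarrow> c' \<in> Poly_Mapping.keys q \<Longrightarrow> a' = a"
  shows "Poly_Mapping.lookup (p * q) (a + c) = Poly_Mapping.lookup p a * Poly_Mapping.lookup q c"
proof -
  have "Poly_Mapping.lookup (p * q) (a + c) =
    (\<Sum>a'\<in>Poly_Mapping.keys p. \<Sum>c'\<in>Poly_Mapping.keys q.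
       if a' = a \<and> c' = c then Poly_Mapping.lookup p a * Poly_Mapping.lookup q c else 0)"
    unfolding lookup_times using assms by (intro sum.cong refl) (metis add_left_cancel)
  also have "\<dots> = (\<Sum>a'\<in>Poly_Mapping.keys p. if a' = a then Poly_Mapping.lookup p a * Poly_Mapping.lookup q c else 0)"
    by (intro sum.cong refl) (auto simp: in_keys_iff if_distrib[of "\<lambda>x. x = _"] sum.neutral cong: if_cong)
  also have "\<dots> = Poly_Mapping.lookup p a * Poly_Mapping.lookup q c"
    by (auto simp: in_keys_iff)
  finally show ?thesis .
qed

lemma lookup_times_eq_0:
  fixes p q :: "'a::comm_monoid_add \<Rightarrow>\<^sub>0 'b::comm_semiring_0"
  assumes "\<And>a c. a + c = b \<Longrightarrow> a \<in> Poly_Mapping.keys p \<Longrightarrow> c \<in> Poly_Mapping.keys q \<Longrightarrow> False"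
  shows "Poly_Mapping.lookup (p * q) b = 0"
  unfolding lookup_times using assms by (intro sum.neutral ballI) (auto intro!: sum.neutral)

lemma single_dvd_single_iff:
  "(Poly_Mapping.single a 1 :: ('v, 'k::field) mpoly) dvd Poly_Mapping.single b 1 \<longleftrightarrow> (\<exists>c. b = a + c)"
proof
  assume "(Poly_Mapping.single a 1 :: ('v, 'k::field) mpoly) dvd Poly_Mapping.single b 1"
  then obtain q :: "('v, 'k) mpoly" where q: "Poly_Mapping.single b 1 = Poly_Mapping.single a 1 * q"
    by (auto simp: dvd_def)
  have "b \<in> Poly_Mapping.keys (Poly_Mapping.single a 1 * q)"
    by (simp flip: q)
  then show "\<exists>c. b = a + c"
    using keys_mult[of "Poly_Mapping.single a 1" q] by (auto split: if_splits)
next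
  assume "\<exists>c. b = a + c"
  then obtain c where "b = a + c" ..
  then have "Poly_Mapping.single b 1 = Poly_Mapping.single a 1 * (Poly_Mapping.single c 1 :: ('v, 'k) mpoly)"
    by (simp add: mult_single)
  then show "(Poly_Mapping.single a 1 :: ('v, 'k::field) mpoly) dvd Poly_Mapping.single b 1"
    by (metis dvd_triv_left)
qed

text \<open>To bound the exponents occurring in an ideal from below it suffices to look at its generators:
  a property of exponents that is stable under multiplication by monomials passes to all combinations.\<close>

lemma keys_ideal_generated:
  fixes G :: "('v::finite, 'k::field) mpoly set"
  assumes "p \<in> ideal_generated G"
    and "\<And>g a. g \<in> G \<Longrightarrow> a \<in> Poly_Mapping.keys g \<Longrightarrow> P a"
    and "\<And>a b. P a \<Longrightarrow> P (b + a)"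
    and "a \<in> Poly_Mapping.keys p"
  shows "P a"
proof -
  have "\<forall>a\<in>Poly_Mapping.keys p. P a"
    using assms(1)
  proof (induction rule: ideal.span_induct_alt)
    case base
    then show ?case by simp
  next
    case (step r g q)
    show ?case
    proof
      fix a assume "a \<in> Poly_Mapping.keys (r * g + q)"
      then consider "a \<in> Poly_Mapping.keys (r * g)" | "a \<in> Poly_Mapping.keys q"
        using keys_add[of "r * g" q] by blast
      then show "P a"
      proof cases
        case 1
        then obtain b c where "a = b + c" "c \<in> Poly_Mapping.keys g"
          using keys_mult[of r g] by blast
        then show ?thesis using assms(2,3) step(1) by blast
      next
        case 2
        then show ?thesis using step by blast
      qed
    qed
  qed
  then show ?thesis using assms(4) by blast
qed


section \<open>Matchings in simplicial forests\<close>

definition complex_of_facets :: "'v::finite set set \<Rightarrow> 'v set set" where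
  "complex_of_facets S = {X. \<exists>F\<in>S. X \<subseteq> F}"

lemma facets_antichain: "F \<in> facets \<Delta> \<Longrightarrow> G \<in> facets \<Delta> \<Longrightarrow> F \<subseteq> G \<Longrightarrow> F = G"
  by (auto simp: facets_def)

lemma face_subset_facet:
  assumes "X \<in> (\<Delta> :: 'v::finite set set)"
  obtains F where "F \<in> facets \<Delta>" "X \<subseteq> F"
proof -
  obtain F where "F \<in> \<Delta>" "X \<subseteq> F" "\<forall>G\<in>\<Delta>. F \<subseteq> G \<longrightarrow> F = G"
    using finite_has_maximal2[OF finite assms] by blast
  then show ?thesis using that[of F] by (simp add: facets_def)
qed

lemma facets_complex_of_facets:
  assumes "S \<subseteq> facets \<Delta>"
  shows "facets (complex_of_facets S) = S"
proof
  show "facets (complex_of_facets S) \<subseteq> S"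
  proof
    fix X assume X: "X \<in> facets (complex_of_facets S)"
    then have "X \<in> complex_of_facets S" by (simp add: facets_def)
    then obtain F where F: "F \<in> S" "X \<subseteq> F" unfolding complex_of_facets_def by blast
    then have "F \<in> complex_of_facets S" by (auto simp: complex_of_facets_def)
    then have "X = F" using X F(2) by (simp add: facets_def)
    then show "X \<in> S" using F(1) by simp
  qed
  show "S \<subseteq> facets (complex_of_facets S)"
  proof
    fix F assume F: "F \<in> S"
    have "F = X" if "X \<in> complex_of_facets S" "F \<subseteq> X" for X
    proof -
      from that(1) obtain G where G: "G \<in> S" "X \<subseteq> G" by (auto simp: complex_of_facets_def)
      then have "F = G" using F assms that(2) by (intro facets_antichain[of F \<Delta> G]) auto
      then show ?thesis using G that by blast
    qed
    moreover have "F \<in> complex_of_facets S" using F by (auto simp: complex_of_facets_def)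
    ultimately show "F \<in> facets (complex_of_facets S)" by (simp add: facets_def)
  qed
qed

lemma subcollection_complex_of_facets:
  assumes "S \<subseteq> facets \<Delta>" "S \<noteq> {}"
  shows "subcollection (complex_of_facets S) \<Delta>"
  unfolding subcollection_def simplicial_complex_def facets_complex_of_facets[OF assms(1)]
  using assms by (auto simp: complex_of_facets_def)

lemma complex_eq_of_facets_eq:
  fixes \<Gamma> \<Gamma>' :: "'v::finite set set"
  assumes "simplicial_complex \<Gamma>" "simplicial_complex \<Gamma>'" "facets \<Gamma> = facets \<Gamma>'"
  shows "\<Gamma> = \<Gamma>'"
proof -
  have "\<Gamma> \<subseteq> \<Gamma>'" if "simplicial_complex \<Gamma>'" "facets \<Gamma> = facets \<Gamma>'" for \<Gamma> \<Gamma>' :: "'v set set"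
  proof
    fix X assume "X \<in> \<Gamma>"
    then obtain F where "F \<in> facets \<Gamma>" "X \<subseteq> F" by (rule face_subset_facet)
    then have "F \<in> facets \<Gamma>'" using that(2) by simp
    then have "F \<in> \<Gamma>'" by (simp add: facets_def)
    then show "X \<in> \<Gamma>'" using that(1) \<open>X \<subseteq> F\<close> unfolding simplicial_complex_def by blast
  qed
  then show ?thesis using assms by (metis subset_antisym)
qed

lemma chained_facets_subset:
  assumes "F \<in> facets \<Delta>"
  shows "{(A, B). A \<in> facets \<Delta> \<and> B \<in> facets \<Delta> \<and> A \<inter> B \<noteq> {}}\<^sup>* `` {F} \<subseteq> facets \<Delta>"
proof
  fix G assume "G \<in> {(A, B). A \<in> facets \<Delta> \<and> B \<in> facets \<Delta> \<and> A \<inter> B \<noteq> {}}\<^sup>* `` {F}"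
  then have "(F, G) \<in> {(A, B). A \<in> facets \<Delta> \<and> B \<in> facets \<Delta> \<and> A \<inter> B \<noteq> {}}\<^sup>*" by simp
  then show "G \<in> facets \<Delta>"
    by (induction rule: rtrancl_induct) (auto simp: assms)
qed

text \<open>The facets that a chain of meeting facets joins to \<open>F\<close> span a component, and it is the only
  connected subcollection containing them: a larger one would have to contain a facet that is joined to \<open>F\<close>.\<close>

lemma component_of_facet:
  assumes F: "F \<in> facets \<Delta>"
  defines "R \<equiv> {(A, B). A \<in> facets \<Delta> \<and> B \<in> facets \<Delta> \<and> A \<inter> B \<noteq> {}}"
  shows "connected_component_of_complex (complex_of_facets (R\<^sup>* `` {F})) \<Delta>"
proof -
  let ?C = "R\<^sup>* `` {F}"
  have C: "?C \<subseteq> facets \<Delta>"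
    unfolding R_def by (rule chained_facets_subset[OF F])
  note fC = facets_complex_of_facets[OF C]
  have sub: "subcollection (complex_of_facets ?C) \<Delta>"
    by (rule subcollection_complex_of_facets[OF C]) auto
  define R' where "R' = {(A, B). A \<in> ?C \<and> B \<in> ?C \<and> A \<inter> B \<noteq> {}}"
  have symR: "sym (R'\<^sup>*)"
    by (rule sym_rtrancl) (auto simp: R'_def sym_def)
  have FG: "(F, G) \<in> R'\<^sup>*" if "G \<in> ?C" for G
  proof -
    have "(F, G) \<in> R\<^sup>*" using that by simp
    then show ?thesis
    proof (induction rule: rtrancl_induct)
      case base
      then show ?case by simp
    next
      case (step A B)
      have "(F, B) \<in> R\<^sup>*" using step by auto
      then have "(A, B) \<in> R'" using step by (auto simp: R'_def R_def)
      then show ?case using step by auto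
    qed
  qed
  have "(A, B) \<in> R'\<^sup>*" if "A \<in> ?C" "B \<in> ?C" for A B
    using FG[OF that(1)] FG[OF that(2)] symR by (meson rtrancl_trans symD)
  then have conn: "complex_connected (complex_of_facets ?C)"
    unfolding complex_connected_def fC R'_def by blast
  have "\<Gamma> = complex_of_facets ?C"
    if \<Gamma>: "subcollection \<Gamma> \<Delta>" "complex_connected \<Gamma>" "complex_of_facets ?C \<subseteq> \<Gamma>" for \<Gamma>
  proof (rule complex_eq_of_facets_eq)
    show "simplicial_complex \<Gamma>" "simplicial_complex (complex_of_facets ?C)"
      using \<Gamma> sub by (auto simp: subcollection_def)
    have f\<Gamma>: "facets \<Gamma> \<subseteq> facets \<Delta>" using \<Gamma> by (simp add: subcollection_def)
    have CG: "?C \<subseteq> facets \<Gamma>"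
    proof
      fix A assume A: "A \<in> ?C"
      then have "A \<in> \<Gamma>" using \<Gamma>(3) by (auto simp: complex_of_facets_def)
      then obtain B where B: "B \<in> facets \<Gamma>" "A \<subseteq> B" by (rule face_subset_facet)
      then have "A = B" using A C f\<Gamma> facets_antichain by blast
      then show "A \<in> facets \<Gamma>" using B by simp
    qed
    have "facets \<Gamma> \<subseteq> ?C"
    proof
      fix A assume "A \<in> facets \<Gamma>"
      moreover have "F \<in> facets \<Gamma>" using CG by auto
      ultimately have "(F, A) \<in> {(A, B). A \<in> facets \<Gamma> \<and> B \<in> facets \<Gamma> \<and> A \<inter> B \<noteq> {}}\<^sup>*"
        using \<Gamma>(2) by (simp add: complex_connected_def)
      then have "(F, A) \<in> R\<^sup>*"
        by (rule rtrancl_mono[THEN subsetD, rotated]) (use f\<Gamma> in \<open>auto simp: R_def\<close>)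
      then show "A \<in> ?C" by simp
    qed
    then show "facets \<Gamma> = facets (complex_of_facets ?C)" using CG fC by auto
  qed
  then show ?thesis
    using sub conn by (simp add: connected_component_of_complex_def)
qed

text \<open>Trees have leaves in every subcollection by definition; this extends it to subcollections that spread
  over several components. A leaf within one component stays a leaf, because the facets from the other
  components do not meet it; if it is alone in its component, any other facet serves as its joint.\<close>

lemma forest_has_leaf:
  assumes "simplicial_forest \<Delta>" "S \<subseteq> facets \<Delta>" "S \<noteq> {}"
  obtains L where "L \<in> S"
    and "S = {L} \<or> (\<exists>G\<in>S. G \<noteq> L \<and> (\<forall>H\<in>S. H \<noteq> L \<longrightarrow> H \<inter> L \<subseteq> G \<inter> L))"
proof -
  obtain F where F: "F \<in> S" using assms by blast
  define R where "R = {(A, B). A \<in> facets \<Delta> \<and> B \<in> facets \<Delta> \<and> A \<inter> B \<noteq> {}}"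
  define C where "C = R\<^sup>* `` {F}"
  have comp: "connected_component_of_complex (complex_of_facets C) \<Delta>"
    using component_of_facet[of F \<Delta>] F assms by (auto simp: C_def R_def)
  then have tree: "simplicial_tree (complex_of_facets C)"
    using assms by (simp add: simplicial_forest_def)
  have Csub: "C \<subseteq> facets \<Delta>"
    unfolding C_def R_def using F assms(2) by (intro chained_facets_subset) blast
  note fC = facets_complex_of_facets[OF Csub]
  let ?T = "S \<inter> C"
  have T: "?T \<subseteq> facets (complex_of_facets C)" "?T \<noteq> {}" using F fC by (auto simp: C_def)
  obtain L where L: "leaf (complex_of_facets ?T) L"
    using tree subcollection_complex_of_facets[OF T] by (auto simp: simplicial_tree_def)
  have LT: "L \<in> ?T" and leafT: "?T = {L} \<or> (\<exists>G\<in>?T. G \<noteq> L \<and> (\<forall>H\<in>?T. H \<noteq> L \<longrightarrow> H \<inter> L \<subseteq> G \<inter> L))"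
    using L unfolding leaf_def facets_complex_of_facets[OF T(1)] by auto
  have out: "H \<inter> L = {}" if "H \<in> S" "H \<notin> C" for H
  proof (rule ccontr)
    assume "H \<inter> L \<noteq> {}"
    then have "(L, H) \<in> R" using that assms LT Csub by (auto simp: R_def)
    moreover have "(F, L) \<in> R\<^sup>*" using LT by (simp add: C_def)
    ultimately have "(F, H) \<in> R\<^sup>*" by (rule rtrancl_into_rtrancl[rotated])
    then show False using that by (simp add: C_def)
  qed
  have "S = {L} \<or> (\<exists>G\<in>S. G \<noteq> L \<and> (\<forall>H\<in>S. H \<noteq> L \<longrightarrow> H \<inter> L \<subseteq> G \<inter> L))"
    using leafT
  proof
    assume one: "?T = {L}"
    then have *: "H \<inter> L = {}" if "H \<in> S" "H \<noteq> L" for H using out that by blast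
    show ?thesis
    proof (cases "S = {L}")
      case False
      then obtain G where "G \<in> S" "G \<noteq> L" using LT by blast
      then show ?thesis using * by blast
    qed simp
  next
    assume "\<exists>G\<in>?T. G \<noteq> L \<and> (\<forall>H\<in>?T. H \<noteq> L \<longrightarrow> H \<inter> L \<subseteq> G \<inter> L)"
    then obtain G where G: "G \<in> ?T" "G \<noteq> L" "\<And>H. H \<in> ?T \<Longrightarrow> H \<noteq> L \<Longrightarrow> H \<inter> L \<subseteq> G \<inter> L" by blast
    have "\<forall>H\<in>S. H \<noteq> L \<longrightarrow> H \<inter> L \<subseteq> G \<inter> L"
    proof (intro ballI impI)
      fix H assume "H \<in> S" "H \<noteq> L"
      then show "H \<inter> L \<subseteq> G \<inter> L" using G(3)[of H] out[of H] by (cases "H \<in> C") auto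
    qed
    then show ?thesis using G by blast
  qed
  then show ?thesis using LT that by blast
qed

text \<open>The edges of the bipartite graph on \<open>\<A>\<close> and \<open>\<B>\<close> in which two sets are joined if they meet.\<close>

definition meeting_pairs :: "'v set set \<Rightarrow> 'v set set \<Rightarrow> ('v set \<times> 'v set) set" where
  "meeting_pairs \<A> \<B> = (SIGMA A:\<A>. {B\<in>\<B>. A \<inter> B \<noteq> {}})"

lemma card_meeting_pairs_commute: "card (meeting_pairs \<A> \<B>) = card (meeting_pairs \<B> \<A>)"
  by (rule bij_betw_same_card[of prod.swap], rule bij_betwI[where g = prod.swap])
    (auto simp: meeting_pairs_def)

lemma card_meeting_pairs:
  "card (meeting_pairs \<A> (\<B> :: 'v::finite set set)) = (\<Sum>A\<in>\<A>. card {B\<in>\<B>. A \<inter> B \<noteq> {}})"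
  by (simp add: meeting_pairs_def)

text \<open>Two sets of \<open>\<B>\<close> meeting the leaf \<open>L\<close> would both meet its joint \<open>G\<close>, inside \<open>L\<close>. Since \<open>G\<close> meets
  \<open>L\<close>, it is not in \<open>\<A>\<close>; so it lies in \<open>\<B>\<close>, where it meets only itself.\<close>

lemma leaf_meets_at_most_one:
  fixes L :: "'v::finite set"
  assumes "disjoint \<A>" "disjoint \<B>" "L \<in> \<A>"
    and leaf: "\<A> \<union> \<B> = {L} \<or> (\<exists>G\<in>\<A> \<union> \<B>. G \<noteq> L \<and> (\<forall>H\<in>\<A> \<union> \<B>. H \<noteq> L \<longrightarrow> H \<inter> L \<subseteq> G \<inter> L))"
    and "\<A> \<inter> \<B> = {}"
  shows "card {B\<in>\<B>. L \<inter> B \<noteq> {}} \<le> 1"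
proof -
  have "B = B'" if B: "B \<in> \<B>" "L \<inter> B \<noteq> {}" and B': "B' \<in> \<B>" "L \<inter> B' \<noteq> {}" for B B'
  proof -
    have BL: "B \<noteq> L" "B' \<noteq> L" using B B' assms by auto
    then obtain G where G: "G \<in> \<A> \<union> \<B>" "G \<noteq> L" "\<And>H. H \<in> \<A> \<union> \<B> \<Longrightarrow> H \<noteq> L \<Longrightarrow> H \<inter> L \<subseteq> G \<inter> L"
      using leaf B by blast
    have *: "B \<inter> L \<subseteq> G \<inter> L" "B' \<inter> L \<subseteq> G \<inter> L" using G(3) B B' BL by blast+
    have "G \<notin> \<A>" using * B assms(1,3) G(2) unfolding disjoint_def by blast
    then have "G \<in> \<B>" using G by blast
    then have "G = B" "G = B'" using * B B' assms(2) unfolding disjoint_def by blast+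
    then show ?thesis by simp
  qed
  then show ?thesis using card_le_Suc0_iff_eq[of "{B\<in>\<B>. L \<inter> B \<noteq> {}}"] by (metis (mono_tags, lifting) One_nat_def finite mem_Collect_eq)
qed

text \<open>The bipartite graph is a forest in the sense of graphs: a leaf of the subcollection \<open>\<A> \<union> \<B>\<close> is a vertex
  of degree at most one, and removing it proves the count by induction.\<close>

lemma card_meeting_pairs_less:
  assumes "simplicial_forest \<Delta>" "\<A> \<union> \<B> \<subseteq> facets \<Delta>" "disjoint \<A>" "disjoint \<B>"
    and "\<A> \<inter> \<B> = {}" "\<A> \<union> \<B> \<noteq> {}"
  shows "card (meeting_pairs \<A> \<B>) < card \<A> + card \<B>"
  using assms(2-)
proof (induction "card \<A> + card \<B>" arbitrary: \<A> \<B> rule: less_induct)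
  case less
  obtain L where L: "L \<in> \<A> \<union> \<B>"
    "\<A> \<union> \<B> = {L} \<or> (\<exists>G\<in>\<A> \<union> \<B>. G \<noteq> L \<and> (\<forall>H\<in>\<A> \<union> \<B>. H \<noteq> L \<longrightarrow> H \<inter> L \<subseteq> G \<inter> L))"
    using forest_has_leaf[OF assms(1) less(2) less(6)] by blast
  \<comment> \<open>Stated for arbitrary families, since the leaf may lie on either side.\<close>
  have step: "card (meeting_pairs \<A> \<B>) < card \<A> + card \<B>"
    if IH: "\<A> - {L} \<union> \<B> \<noteq> {} \<Longrightarrow> card (meeting_pairs (\<A> - {L}) \<B>) < card (\<A> - {L}) + card \<B>"
      and L: "L \<in> \<A>" "\<A> \<union> \<B> = {L} \<or> (\<exists>G\<in>\<A> \<union> \<B>. G \<noteq> L \<and> (\<forall>H\<in>\<A> \<union> \<B>. H \<noteq> L \<longrightarrow> H \<inter> L \<subseteq> G \<inter> L))"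
      and d: "disjoint \<A>" "disjoint \<B>" "\<A> \<inter> \<B> = {}" for \<A> \<B>
  proof (cases "\<A> - {L} \<union> \<B> = {}")
    case True
    then have "\<A> = {L}" "\<B> = {}" using L(1) by blast+
    then show ?thesis by (simp add: card_meeting_pairs)
  next
    case False
    have "card (meeting_pairs \<A> \<B>) = card {B\<in>\<B>. L \<inter> B \<noteq> {}} + card (meeting_pairs (\<A> - {L}) \<B>)"
      unfolding card_meeting_pairs by (rule sum.remove[OF finite L(1)])
    also have "\<dots> < 1 + (card (\<A> - {L}) + card \<B>)"
      using leaf_meets_at_most_one[OF d(1,2) L d(3)] IH[OF False] by linarith
    also have "\<dots> = card \<A> + card \<B>" using card.remove[OF finite L(1)] by simp
    finally show ?thesis .
  qed
  show ?case
  proof (cases "L \<in> \<A>")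
    case True
    have "card (\<A> - {L}) < card \<A>" using True by (intro card_Diff1_less) auto
    then have size: "card (\<A> - {L}) + card \<B> < card \<A> + card \<B>" by simp
    have sub: "\<A> - {L} \<union> \<B> \<subseteq> facets \<Delta>" "disjoint (\<A> - {L})" "(\<A> - {L}) \<inter> \<B> = {}"
      using less(2,3,5) unfolding disjoint_def by blast+
    show ?thesis
      by (rule step[OF less(1)[OF size sub(1,2) less(4) sub(3)] True L(2) less(3-5)])
  next
    case False
    then have LB: "L \<in> \<B>" using L by blast
    have "card (\<B> - {L}) < card \<B>" using LB by (intro card_Diff1_less) auto
    then have size: "card \<A> + card (\<B> - {L}) < card \<A> + card \<B>" by simp
    have sub: "\<A> \<union> (\<B> - {L}) \<subseteq> facets \<Delta>" "disjoint (\<B> - {L})" "\<A> \<inter> (\<B> - {L}) = {}"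
      using less(2,4,5) unfolding disjoint_def by blast+
    have IH: "card (meeting_pairs (\<B> - {L}) \<A>) < card (\<B> - {L}) + card \<A>" if "\<B> - {L} \<union> \<A> \<noteq> {}"
    proof -
      have "\<A> \<union> (\<B> - {L}) \<noteq> {}" using that by blast
      then show ?thesis
        using less(1)[OF size sub(1) less(3) sub(2,3)]
        unfolding card_meeting_pairs_commute[of \<A>] by linarith
    qed
    have L2: "\<B> \<union> \<A> = {L} \<or> (\<exists>G\<in>\<B> \<union> \<A>. G \<noteq> L \<and> (\<forall>H\<in>\<B> \<union> \<A>. H \<noteq> L \<longrightarrow> H \<inter> L \<subseteq> G \<inter> L))"
      using L(2) unfolding Un_commute[of \<A>] .
    have "\<B> \<inter> \<A> = {}" using less(5) by blast
    from step[OF IH LB L2 less(4,3) this]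
    have "card (meeting_pairs \<B> \<A>) < card \<B> + card \<A>" .
    then show ?thesis unfolding card_meeting_pairs_commute[of \<A>] by linarith
  qed
qed

text \<open>If \<open>N\<close> avoids \<open>F\<close>, compare \<open>N - M\<close> with \<open>M - N - {F}\<close>, which have equally many elements. A facet in
  \<open>N - M\<close> is covered by \<open>M - N\<close>. If it met at most one member besides \<open>F\<close>, it would lie in \<open>F \<union> G\<close> for some
  \<open>G\<close> in \<open>M\<close>, against the gap. So all degrees on the side of \<open>N - M\<close> are at least two, which is more edges
  than a forest on that many vertices has, unless \<open>N - M\<close> is empty; and then \<open>N = M - {F}\<close> for reasons of size.\<close>

lemma matching_in_restricted_matching:
  assumes forest: "simplicial_forest \<Delta>" and M: "matching \<Delta> M" and F: "F \<in> M"
    and gap: "\<And>G. G \<in> M - {F} \<Longrightarrow> forms_gap \<Delta> F G"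
    and N: "matching \<Delta> N" "card M = Suc (card N)" "\<Union>N \<subseteq> \<Union>M"
    and ne: "M - {F} \<noteq> {}"
  shows "F \<in> N \<or> N = M - {F}"
proof (rule ccontr)
  assume "\<not> ?thesis"
  then have FN: "F \<notin> N" and NM: "N \<noteq> M - {F}" by auto
  have dM: "disjoint M" "M \<subseteq> facets \<Delta>" and dN: "disjoint N" "N \<subseteq> facets \<Delta>"
    using M N by (auto simp: matching_def)
  let ?A = "M - N - {F}" and ?B = "N - M"
  have cards: "card ?A = card ?B"
  proof -
    have "card (M - N) = card M - card (M \<inter> N)" "card (N - M) = card N - card (M \<inter> N)"
      by (simp_all add: card_Diff_subset_Int Int_commute)
    moreover have "card (M \<inter> N) \<le> card N" by (simp add: card_mono)
    moreover have "card ?A = card (M - N) - 1" using F FN by simp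
    ultimately show ?thesis using N(2) by simp
  qed
  have "?B \<noteq> {}"
  proof
    assume "?B = {}"
    then have "N \<subseteq> M - {F}" using FN by auto
    moreover have "card N = card (M - {F})" using N(2) F by simp
    ultimately show False using NM by (simp add: card_subset_eq)
  qed
  have deg: "2 \<le> card {A\<in>?A. B \<inter> A \<noteq> {}}" if B: "B \<in> ?B" for B
  proof (rule ccontr)
    assume "\<not> ?thesis"
    then have le1: "card {A\<in>?A. B \<inter> A \<noteq> {}} \<le> Suc 0" by linarith
    have "\<exists>G\<in>M - {F}. {A\<in>?A. B \<inter> A \<noteq> {}} \<subseteq> {G}"
    proof (cases "{A\<in>?A. B \<inter> A \<noteq> {}} = {}")
      case True
      obtain G where "G \<in> M - {F}" using ne by blast
      then show ?thesis unfolding True by blast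
    next
      case False
      then obtain G where G: "G \<in> {A\<in>?A. B \<inter> A \<noteq> {}}" by blast
      then have "{A\<in>?A. B \<inter> A \<noteq> {}} \<subseteq> {G}"
        using card_le_Suc0_iff_eq[OF finite, THEN iffD1, OF le1] by blast
      then show ?thesis using G by blast
    qed
    then obtain G where G: "G \<in> M - {F}" "{A\<in>?A. B \<inter> A \<noteq> {}} \<subseteq> {G}" by blast
    have "B \<subseteq> F \<union> G"
    proof
      fix v assume v: "v \<in> B"
      then obtain A where A: "A \<in> M" "v \<in> A" using B N(3) by blast
      have "A \<noteq> B" using A(1) B by blast
      then have "A \<notin> N" using disjointD[OF dN(1), of A B] A(2) v B by blast
      then have "A = F \<or> A \<in> {A\<in>?A. B \<inter> A \<noteq> {}}" using A v by blast
      then have "A = F \<or> A = G" using G(2) by blast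
      then show "v \<in> F \<union> G" using A(2) by blast
    qed
    moreover have "B \<in> facets \<Delta>" using B dN(2) by blast
    ultimately have "B \<in> {H \<in> facets \<Delta>. H \<subseteq> F \<union> G}" by blast
    also have "\<dots> = {F, G}" using gap[OF G(1)] by (simp add: forms_gap_def)
    finally have "B \<in> {F, G}" .
    then show False using B F G by auto
  qed
  have "card (meeting_pairs ?B ?A) < card ?B + card ?A"
    using \<open>?B \<noteq> {}\<close> dM dN by (intro card_meeting_pairs_less[OF forest]) (auto simp: disjoint_def)
  moreover have "card ?B * 2 \<le> card (meeting_pairs ?B ?A)"
    unfolding card_meeting_pairs
    using sum_bounded_below[of ?B 2 "\<lambda>B. card {A\<in>?A. B \<inter> A \<noteq> {}}", OF deg] by simp
  ultimately show False using cards by linarith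
qed


section \<open>Squarefree powers of facet ideals\<close>

definition matching_unions :: "'v::finite set set \<Rightarrow> nat \<Rightarrow> 'v set set" where
  "matching_unions \<Delta> k = {\<Union>N | N. matching \<Delta> N \<and> card N = k}"

lemma card_Union_matching:
  assumes "matching \<Delta> N" "\<And>F. F \<in> facets \<Delta> \<Longrightarrow> card F = d"
  shows "card (\<Union>N) = card N * d"
proof -
  have "card (\<Union>N) = sum card N"
    using assms(1) by (intro card_Union_disjoint) (auto simp: matching_def disjoint_def pairwise_def disjnt_def)
  also have "\<dots> = (\<Sum>F\<in>N. d)"
    using assms by (intro sum.cong refl) (auto simp: matching_def)
  also have "\<dots> = card N * d" by simp
  finally show ?thesis .
qed

lemma keys_ideal_power:
  fixes p :: "('v::finite, 'k::field) mpoly"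
  assumes "p \<in> ideal_power (ideal_generated (squarefree_monomial ` \<F>)) k" "a \<in> Poly_Mapping.keys p"
  shows "\<exists>Fs b. set Fs \<subseteq> \<F> \<and> length Fs = k \<and> a = b + sum_list (map expo Fs)"
  using assms
proof (induction k arbitrary: p a)
  case 0
  then show ?case by (intro exI[of _ "[]"]) auto
next
  case (Suc k)
  let ?P = "\<lambda>a. \<exists>Fs b. set Fs \<subseteq> \<F> \<and> length Fs = Suc k \<and> a = b + sum_list (map expo Fs)"
  have up: "?P (b + a)" if "?P a" for a b
    using that by (metis add.assoc)
  show ?case
  proof (rule keys_ideal_generated[where P = ?P, OF _ _ up Suc.prems(2)])
    show "p \<in> ideal_generated {a * b |a b. a \<in> ideal_generated (squarefree_monomial ` \<F>) \<and>
        b \<in> ideal_power (ideal_generated (squarefree_monomial ` \<F>)) k}"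
      using Suc.prems(1) by simp
  next
    fix g :: "('v, 'k) mpoly" and a
    assume "g \<in> {a * b |a b. a \<in> ideal_generated (squarefree_monomial ` \<F>) \<and>
        b \<in> ideal_power (ideal_generated (squarefree_monomial ` \<F>)) k}" "a \<in> Poly_Mapping.keys g"
    then obtain q r :: "('v, 'k) mpoly" where qr: "q \<in> ideal_generated (squarefree_monomial ` \<F>)"
      "r \<in> ideal_power (ideal_generated (squarefree_monomial ` \<F>)) k" "a \<in> Poly_Mapping.keys (q * r)"
      by blast
    then obtain b c where bc: "a = b + c" "b \<in> Poly_Mapping.keys q" "c \<in> Poly_Mapping.keys r"
      using keys_mult[of q r] by blast
    have "\<exists>F\<in>\<F>. \<exists>b'. b = b' + expo F"
    proof (rule keys_ideal_generated[where P = "\<lambda>b. \<exists>F\<in>\<F>. \<exists>b'. b = b' + expo F", OF qr(1) _ _ bc(2)])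
      fix h :: "('v, 'k) mpoly" and a assume "h \<in> squarefree_monomial ` \<F>" "a \<in> Poly_Mapping.keys h"
      then show "\<exists>F\<in>\<F>. \<exists>b'. a = b' + expo F"
        by (auto simp: squarefree_monomial_eq intro!: bexI exI[of _ 0])
    qed (metis add.assoc)
    then obtain F b' where "F \<in> \<F>" "b = b' + expo F" by blast
    moreover obtain Fs c' where "set Fs \<subseteq> \<F>" "length Fs = k" "c = c' + sum_list (map expo Fs)"
      using Suc.IH[OF qr(2) bc(3)] by blast
    ultimately show "?P a"
      using bc(1) by (intro exI[of _ "F # Fs"] exI[of _ "b' + c'"]) (simp add: ac_simps)
  qed
qed

lemma single_in_ideal_power:
  assumes "set Fs \<subseteq> \<F>"
  shows "(Poly_Mapping.single (sum_list (map expo Fs)) 1 :: ('v::finite, 'k::field) mpoly)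
    \<in> ideal_power (ideal_generated (squarefree_monomial ` \<F>)) (length Fs)"
  using assms
proof (induction Fs)
  case (Cons F Fs)
  have "(Poly_Mapping.single (sum_list (map expo (F # Fs))) 1 :: ('v, 'k) mpoly) =
      squarefree_monomial F * Poly_Mapping.single (sum_list (map expo Fs)) 1"
    by (simp add: squarefree_monomial_eq mult_single)
  moreover have "squarefree_monomial F \<in> (ideal_generated (squarefree_monomial ` \<F>) :: ('v, 'k) mpoly set)"
    using Cons.prems by (intro ideal.span_base) auto
  ultimately show ?case
    using Cons by (auto intro!: ideal.span_base)
qed simp

text \<open>All exponents on the left are at most one, so no vertex is used twice on the right. Non-emptiness
  excludes a repeated empty set.\<close>

lemma expo_eq_sum_list_imp_matching:
  assumes "expo H = sum_list (map expo Fs)" "{} \<notin> set Fs"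
  shows "distinct Fs \<and> disjoint (set Fs) \<and> H = \<Union>(set Fs)"
  using assms
proof (induction Fs arbitrary: H)
  case Nil
  then have "expo H = expo {}" by simp
  then have "H = {}" by (simp only: expo_inject)
  then show ?case by (simp add: disjoint_def)
next
  case (Cons F Fs)
  have eq: "expo H = sum_list (map expo Fs) + expo F" using Cons.prems by (simp add: add.commute)
  then have FH: "F \<subseteq> H" by (rule subset_of_expo_eq_add)
  then have "expo (H - F) = sum_list (map expo Fs)"
    using eq expo_diff_add[OF FH] by (metis add_right_cancel)
  then have IH: "distinct Fs" "disjoint (set Fs)" "H - F = \<Union>(set Fs)"
    using Cons by auto
  then have "F \<inter> G = {}" if "G \<in> set Fs" for G using that by blast
  moreover have "F \<notin> set Fs" using IH(3) Cons.prems(2) by fastforce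
  ultimately show ?case using IH FH unfolding disjoint_def by auto
qed

lemma sum_list_expo_of_disjoint:
  assumes "distinct Fs" "disjoint (set Fs)"
  shows "sum_list (map expo Fs) = expo (\<Union>(set Fs))"
  using assms
proof (induction Fs)
  case (Cons F Fs)
  then have "F \<inter> \<Union>(set Fs) = {}" unfolding disjoint_def by auto
  then have "expo (F \<union> \<Union>(set Fs)) = expo F + expo (\<Union>(set Fs))" by (rule expo_union_disjoint)
  then show ?case using Cons by (simp add: disjoint_def)
qed simp

lemma exponent_degree_sum_list_expo:
  assumes "\<And>F. F \<in> set Fs \<Longrightarrow> card F = d"
  shows "exponent_degree (sum_list (map expo Fs)) = length Fs * d"
  using assms by (induction Fs) (auto simp: exponent_degree_add exponent_degree_eq_0)

text \<open>All products of \<open>k\<close> facet monomials have the same degree, so each of them is a minimal generator of the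
  \<open>k\<close>-th power, and such a product is squarefree exactly if its factors are pairwise disjoint.\<close>

lemma squarefree_power_facet_ideal:
  fixes \<Delta> :: "'v::finite set set"
  assumes d: "\<And>F. F \<in> facets \<Delta> \<Longrightarrow> card F = d" "d > 0"
  shows "squarefree_power (facet_ideal \<Delta> :: ('v, 'k::field) mpoly set) k =
    ideal_generated (squarefree_monomial ` matching_unions \<Delta> k)"
proof -
  let ?I = "ideal_power (facet_ideal \<Delta>) k :: ('v, 'k) mpoly set"
  have "{u \<in> minimal_monomial_generators ?I. \<exists>F. u = squarefree_monomial F} =
    squarefree_monomial ` matching_unions \<Delta> k"
  proof (intro subset_antisym subsetI)
    fix u assume u: "u \<in> {u \<in> minimal_monomial_generators ?I. \<exists>F. u = squarefree_monomial F}"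
    then obtain H where H: "u = squarefree_monomial H" by blast
    have uI: "u \<in> ?I" and umin: "\<And>w. w \<in> monomials \<Longrightarrow> w \<in> ?I \<Longrightarrow> w dvd u \<Longrightarrow> w = u"
      using u by (auto simp: minimal_monomial_generators_def)
    obtain Fs b where Fs: "set Fs \<subseteq> facets \<Delta>" "length Fs = k" "expo H = b + sum_list (map expo Fs)"
      using keys_ideal_power[of u "facets \<Delta>" k "expo H"] uI H
      by (auto simp: squarefree_monomial_eq facet_ideal_def)
    let ?w = "Poly_Mapping.single (sum_list (map expo Fs)) 1 :: ('v, 'k) mpoly"
    have "?w \<in> ?I"
      using single_in_ideal_power[OF Fs(1)] by (simp add: Fs(2) facet_ideal_def)
    moreover have "?w dvd u"
      unfolding H squarefree_monomial_eq single_dvd_single_iff by (metis Fs(3) add.commute)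
    ultimately have "?w = u"
      by (intro umin) (auto simp: monomials_def)
    then have "sum_list (map expo Fs) = expo H"
      by (metis H squarefree_monomial_eq keys_single singleton_inject zero_neq_one)
    moreover have "{} \<notin> set Fs" using Fs(1) d by force
    ultimately have "distinct Fs" "disjoint (set Fs)" "H = \<Union>(set Fs)"
      using expo_eq_sum_list_imp_matching[of H Fs] by auto
    then have "H \<in> matching_unions \<Delta> k"
      using Fs by (auto simp: matching_unions_def matching_def distinct_card intro!: exI[of _ "set Fs"])
    then show "u \<in> squarefree_monomial ` matching_unions \<Delta> k"
      using H by blast
  next
    fix u :: "('v, 'k) mpoly" assume "u \<in> squarefree_monomial ` matching_unions \<Delta> k"
    then obtain N where N: "matching \<Delta> N" "card N = k" and u: "u = squarefree_monomial (\<Union>N)"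
      by (auto simp: matching_unions_def)
    obtain Fs where Fs: "set Fs = N" "distinct Fs" using finite_distinct_list[of N] by auto
    then have lFs: "length Fs = k" using N by (metis distinct_card)
    have sFs: "set Fs \<subseteq> facets \<Delta>" using Fs N by (simp add: matching_def)
    have "sum_list (map expo Fs) = expo (\<Union>N)"
      using sum_list_expo_of_disjoint[OF Fs(2)] Fs N by (simp add: matching_def)
    then have uI: "u \<in> ?I" "u \<in> monomials"
      using single_in_ideal_power[OF sFs] by (auto simp: lFs u squarefree_monomial_eq facet_ideal_def monomials_def)
    have "w = u" if w: "w \<in> monomials" "w \<in> ?I" "w dvd u" for w
    proof -
      obtain b where b: "w = Poly_Mapping.single b 1" using w by (auto simp: monomials_def)
      obtain c where c: "expo (\<Union>N) = b + c"
        using w(3) unfolding b u squarefree_monomial_eq single_dvd_single_iff by blast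
      obtain Gs b' where Gs: "set Gs \<subseteq> facets \<Delta>" "length Gs = k" "b = b' + sum_list (map expo Gs)"
        using keys_ideal_power[of w "facets \<Delta>" k b] w b by (auto simp: facet_ideal_def)
      have "k * d = exponent_degree (expo (\<Union>N))"
        using card_Union_matching[OF N(1) d(1)] N(2) by simp
      also have "\<dots> = exponent_degree b' + k * d + exponent_degree c"
        unfolding c Gs(3) exponent_degree_add using exponent_degree_sum_list_expo[of Gs d] Gs(1,2) d(1) by auto
      finally have "c = 0" by (simp add: exponent_degree_eq_0)
      then show ?thesis using b c u by (simp add: squarefree_monomial_eq)
    qed
    then show "u \<in> {u \<in> minimal_monomial_generators ?I. \<exists>F. u = squarefree_monomial F}"
      using u uI by (auto simp: minimal_monomial_generators_def)
  qed
  then show ?thesis by (simp add: squarefree_power_def)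
qed


section \<open>Minimal resolutions of squarefree monomial ideals\<close>

text \<open>
  The resolution is built multigraded. Every basis element of every \<open>F\<^sub>i\<close> carries a label, a subset \<open>A\<close> of
  the vertex set standing for the multidegree \<open>x\<^sup>A\<close>. A homogeneous map between such modules is a scalar
  matrix: its entry in the row labelled \<open>B\<close> and the column labelled \<open>A\<close> is \<open>c x\<^sup>A\<^sup>-\<^sup>B\<close>, with \<open>c = 0\<close> unless
  \<open>B \<subseteq> A\<close>. A column is stored as the pair \<open>(A, c)\<close> of its label and its scalar entries.

  The kernel in multidegree \<open>a\<close> consists of the scalar relations among the columns whose label divides
  \<open>a\<close>. As labels are squarefree, these only depend on the set of variables in \<open>a\<close>; hence the kernel is
  generated by finite-dimensional spaces of scalar relations, one for each subset of the vertex set. In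
  particular the labels of the next module are subsets again.
\<close>

definition scale_column :: "'k::field \<Rightarrow> (nat \<Rightarrow> 'k) \<Rightarrow> nat \<Rightarrow> 'k" where
  "scale_column r c = (\<lambda>m. r * c m)"

lemma scale_column_apply [simp]: "scale_column r c m = r * c m"
  by (simp add: scale_column_def)

interpretation column: vector_space scale_column
  by unfold_locales (auto simp: fun_eq_iff distrib_left distrib_right)

lemma sum_column_apply: "(\<Sum>i\<in>S. (f i :: nat \<Rightarrow> 'k::field)) m = (\<Sum>i\<in>S. f i m)"
  by (induction S rule: infinite_finite_induct) auto

definition columns_below :: "('v set \<times> (nat \<Rightarrow> 'k)) set \<Rightarrow> 'v set \<Rightarrow> (nat \<Rightarrow> 'k) set" where
  "columns_below Y A = {c. \<exists>B\<subseteq>A. (B, c) \<in> Y}"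

definition relations :: "('v set \<times> (nat \<Rightarrow> 'k::field)) list \<Rightarrow> 'v set \<Rightarrow> (nat \<Rightarrow> 'k) set" where
  "relations xs A = {c. (\<forall>l. c l \<noteq> 0 \<longrightarrow> l < length xs \<and> fst (xs ! l) \<subseteq> A) \<and>
     (\<forall>m. (\<Sum>l<length xs. c l * snd (xs ! l) m) = 0)}"

text \<open>A set of columns for the next map: they are relations among the columns \<open>xs\<close>, and for every label
  they span the scalar relations supported below that label.\<close>

definition generates_relations :: "('v set \<times> (nat \<Rightarrow> 'k::field)) set \<Rightarrow> ('v set \<times> (nat \<Rightarrow> 'k)) list \<Rightarrow> bool" where
  "generates_relations Y xs \<longleftrightarrow> (\<forall>(A, c)\<in>Y. c \<in> relations xs A) \<and>
     (\<forall>A. relations xs A \<subseteq> column.span (columns_below Y A))"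

text \<open>No column is a combination of the other ones that can be multiplied into its multidegree; this makes
  the columns a minimal system of generators.\<close>

definition irredundant :: "('v set \<times> (nat \<Rightarrow> 'k::field)) set \<Rightarrow> bool" where
  "irredundant Y \<longleftrightarrow> (\<forall>(A, c)\<in>Y. c \<notin> column.span (columns_below (Y - {(A, c)}) A))"

lemma relationsI:
  assumes "\<And>l. c l \<noteq> 0 \<Longrightarrow> l < length xs \<and> fst (xs ! l) \<subseteq> A"
    and "\<And>m. (\<Sum>l<length xs. c l * snd (xs ! l) m) = 0"
  shows "c \<in> relations xs A"
  unfolding relations_def using assms by blast

lemma relations_support:
  "c \<in> relations xs A \<Longrightarrow> c l \<noteq> 0 \<Longrightarrow> l < length xs \<and> fst (xs ! l) \<subseteq> A"
  unfolding relations_def by blast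

lemma relations_sum:
  "c \<in> relations xs A \<Longrightarrow> (\<Sum>l<length xs. c l * snd (xs ! l) m) = 0"
  unfolding relations_def by blast

lemma relations_finite_dimensional:
  fixes xs :: "('v set \<times> (nat \<Rightarrow> 'k::field)) list"
  obtains B where "finite B" "B \<subseteq> relations xs A" "relations xs A \<subseteq> column.span B"
proof -
  let ?\<delta> = "\<lambda>l m. if m = l then 1 else 0 :: 'k"
  have sub: "relations xs A \<subseteq> column.span (?\<delta> ` {..<length xs})"
  proof
    fix c assume c: "c \<in> relations xs A"
    have "c = (\<Sum>l<length xs. scale_column (c l) (?\<delta> l))"
    proof
      fix m
      have "(\<Sum>l<length xs. scale_column (c l) (?\<delta> l)) m = (if m < length xs then c m else 0)"
        by (simp add: sum_column_apply if_distrib[of "\<lambda>x. _ * x"] cong: if_cong)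
      also have "\<dots> = c m" using relations_support[OF c, of m] by auto
      finally show "c m = (\<Sum>l<length xs. scale_column (c l) (?\<delta> l)) m" by simp
    qed
    also have "\<dots> \<in> column.span (?\<delta> ` {..<length xs})"
      by (intro column.span_sum column.span_scale column.span_base) auto
    finally show "c \<in> column.span (?\<delta> ` {..<length xs})" .
  qed
  obtain B where B: "B \<subseteq> relations xs A" "column.independent B" "relations xs A \<subseteq> column.span B"
    by (rule column.maximal_independent_subset)
  have "finite B"
    using column.independent_span_bound[OF _ B(2)] B(1) sub by (meson finite_imageI finite_lessThan order_trans)
  then show ?thesis using B that by blast
qed

lemma columns_below_mono: "A \<subseteq> A' \<Longrightarrow> columns_below Y A \<subseteq> columns_below Y A'"
  by (auto simp: columns_below_def)

text \<open>Collect a finite basis for each of the finitely many labels; a generating set of least cardinality is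
  irredundant.\<close>

lemma exists_irredundant_generating_set:
  fixes xs :: "('v::finite set \<times> (nat \<Rightarrow> 'k::field)) list"
  shows "\<exists>Y. finite Y \<and> generates_relations Y xs \<and> irredundant Y"
proof -
  have "\<forall>A. \<exists>B. finite B \<and> B \<subseteq> relations xs A \<and> relations xs A \<subseteq> column.span B"
    using relations_finite_dimensional by metis
  then obtain B where B: "\<And>A. finite (B A)" "\<And>A. B A \<subseteq> relations xs A" "\<And>A. relations xs A \<subseteq> column.span (B A)"
    by metis
  let ?P = "\<lambda>Y. finite Y \<and> generates_relations Y xs"
  have "relations xs A \<subseteq> column.span (columns_below (SIGMA A:UNIV. B A) A)" for A
    by (rule order_trans[OF B(3) column.span_mono]) (auto simp: columns_below_def)
  moreover have "finite (SIGMA A:UNIV. B A)" using B(1) by (intro finite_SigmaI) auto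
  ultimately have "?P (SIGMA A:UNIV. B A)"
    using B(2) unfolding generates_relations_def by blast
  from ex_has_least_nat[of ?P, OF this, of card]
  obtain Y where Y: "?P Y" and min: "\<And>Y'. ?P Y' \<Longrightarrow> card Y \<le> card Y'" by blast
  have "c \<notin> column.span (columns_below (Y - {(A, c)}) A)" if Ac: "(A, c) \<in> Y" for A c
  proof
    assume c: "c \<in> column.span (columns_below (Y - {(A, c)}) A)"
    have "columns_below Y A' \<subseteq> column.span (columns_below (Y - {(A, c)}) A')" for A'
    proof
      fix b assume "b \<in> columns_below Y A'"
      then obtain A'' where A'': "A'' \<subseteq> A'" "(A'', b) \<in> Y" by (auto simp: columns_below_def)
      show "b \<in> column.span (columns_below (Y - {(A, c)}) A')"
      proof (cases "(A'', b) = (A, c)")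
        case True
        then show ?thesis
          using c A''(1) column.span_mono[OF columns_below_mono] by blast
      next
        case False
        then show ?thesis
          using A'' by (intro column.span_base) (auto simp: columns_below_def)
      qed
    qed
    then have "column.span (columns_below Y A') \<subseteq> column.span (columns_below (Y - {(A, c)}) A')" for A'
      by (intro column.span_minimal column.subspace_span)
    then have "?P (Y - {(A, c)})"
      using Y unfolding generates_relations_def by blast
    then have "card Y \<le> card (Y - {(A, c)})" by (rule min)
    moreover have "card (Y - {(A, c)}) < card Y" using Y Ac by (intro card_Diff1_less) auto
    ultimately show False by simp
  qed
  then show ?thesis using Y unfolding irredundant_def by blast
qed

text \<open>The source of minimality: a relation in multidegree \<open>A\<close> with a non-zero coefficient at a column labelled
  \<open>A\<close> would express that column by the others. So unit entries cannot occur in the next matrix.\<close>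

lemma irredundant_relation_eq_0:
  assumes "distinct ys" "irredundant (set ys)" "c \<in> relations ys (fst (ys ! l))" "l < length ys"
  shows "c l = 0"
proof (rule ccontr)
  assume cl: "c l \<noteq> 0"
  let ?A = "fst (ys ! l)"
  let ?Y = "columns_below (set ys - {(?A, snd (ys ! l))}) ?A"
  have "snd (ys ! l) = (\<Sum>l'\<in>{..<length ys} - {l}. scale_column (- (c l' / c l)) (snd (ys ! l')))"
  proof
    fix m
    have "0 = (\<Sum>l'<length ys. c l' * snd (ys ! l') m)"
      using relations_sum[OF assms(3)] by simp
    also have "\<dots> = c l * snd (ys ! l) m + (\<Sum>l'\<in>{..<length ys} - {l}. c l' * snd (ys ! l') m)"
      using sum.remove[of "{..<length ys}" l] assms(4) by simp
    finally have "c l * snd (ys ! l) m = - (\<Sum>l'\<in>{..<length ys} - {l}. c l' * snd (ys ! l') m)"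
      by (rule eq_neg_iff_add_eq_0[THEN iffD2, OF sym])
    then have "snd (ys ! l) m = - (\<Sum>l'\<in>{..<length ys} - {l}. c l' * snd (ys ! l') m) / c l"
      using nonzero_mult_div_cancel_left[OF cl] by metis
    then show "snd (ys ! l) m = (\<Sum>l'\<in>{..<length ys} - {l}. scale_column (- (c l' / c l)) (snd (ys ! l'))) m"
      by (simp add: sum_column_apply sum_divide_distrib sum_negf)
  qed
  also have "\<dots> \<in> column.span ?Y"
  proof (intro column.span_sum)
    fix l' assume l': "l' \<in> {..<length ys} - {l}"
    show "scale_column (- (c l' / c l)) (snd (ys ! l')) \<in> column.span ?Y"
    proof (cases "c l' = 0")
      case True
      then show ?thesis by (simp add: column.span_zero)
    next
      case False
      then have "fst (ys ! l') \<subseteq> ?A" using relations_support[OF assms(3)] by blast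
      moreover have "ys ! l' \<noteq> ys ! l" using l' assms(1,4) by (simp add: nth_eq_iff_index_eq)
      moreover have "ys ! l' \<in> set ys" using l' by simp
      ultimately have "snd (ys ! l') \<in> ?Y"
        unfolding columns_below_def by (auto intro!: exI[of _ "fst (ys ! l')"])
      then show ?thesis by (intro column.span_scale column.span_base)
    qed
  qed
  finally have "snd (ys ! l) \<in> column.span ?Y" .
  moreover have "(?A, snd (ys ! l)) \<in> set ys" using assms(4) by simp
  ultimately show False using assms(2) unfolding irredundant_def by blast
qed

lemma span_columns_below_coefficients:
  assumes "c \<in> column.span (columns_below (set ys) A)"
  shows "\<exists>r. (\<forall>l. r l \<noteq> 0 \<longrightarrow> l < length ys \<and> fst (ys ! l) \<subseteq> A) \<and>
    (\<forall>p. c p = (\<Sum>l<length ys. r l * snd (ys ! l) p))"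
  using assms
proof (induction rule: column.span_induct_alt)
  case base
  then show ?case by (intro exI[of _ "\<lambda>_. 0"]) auto
next
  case (step x b c)
  then obtain r where r: "\<forall>l. r l \<noteq> 0 \<longrightarrow> l < length ys \<and> fst (ys ! l) \<subseteq> A"
    "\<forall>p. c p = (\<Sum>l<length ys. r l * snd (ys ! l) p)" by blast
  obtain k where k: "k < length ys" "fst (ys ! k) \<subseteq> A" "snd (ys ! k) = b"
    using step(1) by (force simp: columns_below_def in_set_conv_nth)
  let ?r = "\<lambda>l. (if l = k then x else 0) + r l"
  have "(\<Sum>l<length ys. ?r l * snd (ys ! l) p) = x * b p + c p" for p
    using k r(2) by (simp add: distrib_right sum.distrib if_distrib[of "\<lambda>x. x * _"] cong: if_cong)
  then show ?case using r(1) k by (intro exI[of _ ?r]) auto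
qed

definition label_matrix :: "'v::finite set list \<Rightarrow> ('v set \<times> (nat \<Rightarrow> 'k::field)) list \<Rightarrow> ('v, 'k) mpoly mat" where
  "label_matrix Bs xs = mat (length Bs) (length xs)
     (\<lambda>(m, l). Poly_Mapping.single (expo (fst (xs ! l) - Bs ! m)) (snd (xs ! l) m))"

definition supported_on :: "'v set list \<Rightarrow> ('v set \<times> (nat \<Rightarrow> 'k::field)) list \<Rightarrow> bool" where
  "supported_on Bs xs \<longleftrightarrow> (\<forall>l<length xs. \<forall>m. snd (xs ! l) m \<noteq> 0 \<longrightarrow> m < length Bs \<and> Bs ! m \<subseteq> fst (xs ! l))"

lemma generates_relations_nth:
  "generates_relations (set ys) xs \<Longrightarrow> l < length ys \<Longrightarrow> snd (ys ! l) \<in> relations xs (fst (ys ! l))"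
  unfolding generates_relations_def by (metis (mono_tags, lifting) case_prod_beta nth_mem)

lemma supported_on_generates_relations:
  "generates_relations (set ys) xs \<Longrightarrow> supported_on (map fst xs) ys"
  unfolding supported_on_def using relations_support[OF generates_relations_nth] by fastforce

lemma expo_minus_add: "A \<subseteq> Poly_Mapping.keys a \<Longrightarrow> (a - expo A) + expo A = a"
  using subset_keys_iff[of A a] by auto

lemma expo_diff_add_minus:
  assumes "B \<subseteq> A" "A \<subseteq> Poly_Mapping.keys a"
  shows "expo (A - B) + (a - expo A) = a - expo B"
proof -
  have "(expo (A - B) + (a - expo A)) + expo B = (a - expo A) + expo A"
    using expo_diff_add[OF assms(1)] by (metis add.assoc add.commute)
  also have "\<dots> = (a - expo B) + expo B"
    using expo_minus_add assms by (metis order_trans)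
  finally show ?thesis by simp
qed

lemma expo_diff_add_diff:
  assumes "B \<subseteq> A" "A \<subseteq> C"
  shows "expo (A - B) + expo (C - A) = expo (C - B)"
  using assms by (subst expo_union_disjoint[symmetric]) (auto intro: arg_cong[of _ _ expo])

text \<open>In each entry all summands of the matrix product have the same monomial, so it is the scalar
  relation that makes the product vanish.\<close>

lemma label_matrix_mult_eq_0:
  assumes "supported_on Bs xs" "generates_relations (set ys) xs"
  shows "label_matrix Bs xs * label_matrix (map fst xs) ys = 0\<^sub>m (length Bs) (length ys)"
proof (rule eq_matI)
  fix m l assume ml: "m < dim_row (0\<^sub>m (length Bs) (length ys))" "l < dim_col (0\<^sub>m (length Bs) (length ys))"
  have rel: "snd (ys ! l) \<in> relations xs (fst (ys ! l))"
    using generates_relations_nth[OF assms(2)] ml by simp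
  have "(label_matrix Bs xs * label_matrix (map fst xs) ys) $$ (m, l) =
    (\<Sum>p<length xs. Poly_Mapping.single (expo (fst (xs ! p) - Bs ! m)) (snd (xs ! p) m) *
       Poly_Mapping.single (expo (fst (ys ! l) - fst (xs ! p))) (snd (ys ! l) p))"
    using ml by (auto simp: label_matrix_def scalar_prod_def atLeast0LessThan intro!: sum.cong)
  also have "\<dots> = (\<Sum>p<length xs. Poly_Mapping.single (expo (fst (ys ! l) - Bs ! m)) (snd (ys ! l) p * snd (xs ! p) m))"
  proof (intro sum.cong refl)
    fix p assume p: "p \<in> {..<length xs}"
    show "Poly_Mapping.single (expo (fst (xs ! p) - Bs ! m)) (snd (xs ! p) m) *
       Poly_Mapping.single (expo (fst (ys ! l) - fst (xs ! p))) (snd (ys ! l) p) =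
       Poly_Mapping.single (expo (fst (ys ! l) - Bs ! m)) (snd (ys ! l) p * snd (xs ! p) m)"
    proof (cases "snd (xs ! p) m = 0 \<or> snd (ys ! l) p = 0")
      case False
      then have "Bs ! m \<subseteq> fst (xs ! p)" "fst (xs ! p) \<subseteq> fst (ys ! l)"
        using p assms(1) relations_support[OF rel, of p] by (simp_all add: supported_on_def)
      then show ?thesis by (simp only: mult_single expo_diff_add_diff mult.commute)
    qed auto
  qed
  also have "\<dots> = Poly_Mapping.single (expo (fst (ys ! l) - Bs ! m)) (\<Sum>p<length xs. snd (ys ! l) p * snd (xs ! p) m)"
    by (rule poly_mapping_eqI) (simp add: lookup_sum lookup_single when_def)
  also have "\<dots> = 0"
    unfolding relations_sum[OF rel] by simp
  finally show "(label_matrix Bs xs * label_matrix (map fst xs) ys) $$ (m, l) = 0\<^sub>m (length Bs) (length ys) $$ (m, l)"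
    using ml by simp
qed (auto simp: label_matrix_def)

text \<open>The scalars in the component of multidegree \<open>a\<close>, for basis elements labelled \<open>As\<close>.\<close>

definition multidegree_part ::
  "'v::finite set list \<Rightarrow> ('v, 'k::field) mpoly vec \<Rightarrow> ('v \<Rightarrow>\<^sub>0 nat) \<Rightarrow> nat \<Rightarrow> 'k" where
  "multidegree_part As w a p =
     (if p < length As \<and> As ! p \<subseteq> Poly_Mapping.keys a then Poly_Mapping.lookup (w $ p) (a - expo (As ! p)) else 0)"

lemma label_matrix_mult_vec:
  assumes "w \<in> carrier_vec (length xs)" "m < length Bs"
  shows "(label_matrix Bs xs *\<^sub>v w) $ m =
    (\<Sum>p<length xs. Poly_Mapping.single (expo (fst (xs ! p) - Bs ! m)) (snd (xs ! p) m) * w $ p)"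
  using assms by (auto simp: label_matrix_def scalar_prod_def atLeast0LessThan intro!: sum.cong)

lemma multidegree_part_in_relations:
  assumes "supported_on Bs xs" "w \<in> carrier_vec (length xs)" "label_matrix Bs xs *\<^sub>v w = 0\<^sub>v (length Bs)"
  shows "multidegree_part (map fst xs) w a \<in> relations xs (Poly_Mapping.keys a)"
proof -
  let ?c = "multidegree_part (map fst xs) w a"
  have "(\<Sum>p<length xs. ?c p * snd (xs ! p) m) = 0" for m
  proof (cases "m < length Bs \<and> Bs ! m \<subseteq> Poly_Mapping.keys a")
    case False
    have "?c p * snd (xs ! p) m = 0" if p: "p < length xs" for p
    proof (rule ccontr)
      assume "?c p * snd (xs ! p) m \<noteq> 0"
      then have "m < length Bs" "Bs ! m \<subseteq> fst (xs ! p)" "fst (xs ! p) \<subseteq> Poly_Mapping.keys a"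
        using assms(1) p by (auto simp: supported_on_def multidegree_part_def split: if_splits)
      then show False using False by blast
    qed
    then show ?thesis by (intro sum.neutral ballI) (simp only: lessThan_iff)
  next
    case True
    have "Poly_Mapping.lookup (Poly_Mapping.single (expo (fst (xs ! p) - Bs ! m)) (snd (xs ! p) m) * w $ p) (a - expo (Bs ! m)) =
      ?c p * snd (xs ! p) m" if p: "p < length xs" for p
    proof (cases "snd (xs ! p) m = 0")
      case nz: False
      then have B: "Bs ! m \<subseteq> fst (xs ! p)" using assms(1) p by (simp add: supported_on_def)
      show ?thesis
      proof (cases "fst (xs ! p) \<subseteq> Poly_Mapping.keys a")
        case True
        then show ?thesis using p
          unfolding expo_diff_add_minus[OF B True, symmetric]
          by (subst lookup_times_eq_single_term) (auto simp: multidegree_part_def split: if_splits)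
      next
        case False
        have "Poly_Mapping.lookup (Poly_Mapping.single (expo (fst (xs ! p) - Bs ! m)) (snd (xs ! p) m) * w $ p) (a - expo (Bs ! m)) = 0"
        proof (rule lookup_times_eq_0)
          fix b c assume bc: "b + c = a - expo (Bs ! m)"
            "b \<in> Poly_Mapping.keys (Poly_Mapping.single (expo (fst (xs ! p) - Bs ! m)) (snd (xs ! p) m))"
          then have b: "b = expo (fst (xs ! p) - Bs ! m)" by (simp split: if_splits)
          have "a = a - expo (Bs ! m) + expo (Bs ! m)"
            using expo_minus_add \<open>m < length Bs \<and> Bs ! m \<subseteq> Poly_Mapping.keys a\<close> by metis
          also have "\<dots> = c + (b + expo (Bs ! m))"
            unfolding bc(1)[symmetric] by (simp only: ac_simps)
          also have "\<dots> = c + expo (fst (xs ! p))"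
            unfolding b expo_diff_add[OF B] ..
          finally have "fst (xs ! p) \<subseteq> Poly_Mapping.keys a"
            unfolding subset_keys_iff by blast
          then show False using False by blast
        qed
        then show ?thesis using False by (simp add: multidegree_part_def p)
      qed
    qed simp
    then have "(\<Sum>p<length xs. ?c p * snd (xs ! p) m) = Poly_Mapping.lookup ((label_matrix Bs xs *\<^sub>v w) $ m) (a - expo (Bs ! m))"
      using True by (simp add: label_matrix_mult_vec[OF assms(2)] lookup_sum)
    then show ?thesis using assms(3) True by simp
  qed
  moreover have "?c p \<noteq> 0 \<longrightarrow> p < length xs \<and> fst (xs ! p) \<subseteq> Poly_Mapping.keys a" for p
    by (auto simp: multidegree_part_def split: if_splits)
  ultimately show ?thesis by (intro relationsI) blast+
qed

text \<open>A kernel element \<open>w\<close> is the sum of its multihomogeneous components; each is a scalar relation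
  multiplied by a monomial, so it is a combination of the generating relations. The coefficients of these
  combinations, multiplied by the complementary monomials, add up to the preimage \<open>z\<close>.\<close>

lemma kernel_label_matrix:
  fixes xs ys :: "('v::finite set \<times> (nat \<Rightarrow> 'k::field)) list"
  assumes sup: "supported_on Bs xs" and gen: "generates_relations (set ys) xs"
  shows "mat_kernel (label_matrix Bs xs) =
    {label_matrix (map fst xs) ys *\<^sub>v w | w. w \<in> carrier_vec (length ys)}"
proof (intro subset_antisym subsetI)
  fix w assume "w \<in> mat_kernel (label_matrix Bs xs)"
  then have w: "w \<in> carrier_vec (length xs)" "label_matrix Bs xs *\<^sub>v w = 0\<^sub>v (length Bs)"
    by (auto simp: mat_kernel_def label_matrix_def)
  let ?c = "multidegree_part (map fst xs) w"
  have "?c a \<in> column.span (columns_below (set ys) (Poly_Mapping.keys a))" for a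
    using multidegree_part_in_relations[OF sup w, of a] gen unfolding generates_relations_def by blast
  then have "\<forall>a. \<exists>r. (\<forall>l. r l \<noteq> 0 \<longrightarrow> l < length ys \<and> fst (ys ! l) \<subseteq> Poly_Mapping.keys a) \<and>
      (\<forall>p. ?c a p = (\<Sum>l<length ys. r l * snd (ys ! l) p))"
    by (intro allI span_columns_below_coefficients)
  then obtain r where r: "\<And>a l. r a l \<noteq> 0 \<Longrightarrow> l < length ys \<and> fst (ys ! l) \<subseteq> Poly_Mapping.keys a"
    and rc: "\<And>a p. ?c a p = (\<Sum>l<length ys. r a l * snd (ys ! l) p)"
    using choice[of "\<lambda>a r. (\<forall>l. r l \<noteq> 0 \<longrightarrow> l < length ys \<and> fst (ys ! l) \<subseteq> Poly_Mapping.keys a) \<and>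
      (\<forall>p. ?c a p = (\<Sum>l<length ys. r l * snd (ys ! l) p))"] by blast
  \<comment> \<open>the finitely many multidegrees in which \<open>w\<close> has a component\<close>
  define E where "E = (\<Union>p<length xs. (\<lambda>b. b + expo (fst (xs ! p))) ` Poly_Mapping.keys (w $ p))"
  have finE: "finite E" by (simp add: E_def)
  define z where "z = vec (length ys) (\<lambda>l. \<Sum>a\<in>E. Poly_Mapping.single (a - expo (fst (ys ! l))) (r a l))"
  have z: "z \<in> carrier_vec (length ys)" by (simp add: z_def)
  have "(label_matrix (map fst xs) ys *\<^sub>v z) $ p = w $ p" if p: "p < length xs" for p
  proof -
    let ?A = "fst (xs ! p)"
    have "(label_matrix (map fst xs) ys *\<^sub>v z) $ p =
      (\<Sum>l<length ys. Poly_Mapping.single (expo (fst (ys ! l) - ?A)) (snd (ys ! l) p) *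
         (\<Sum>a\<in>E. Poly_Mapping.single (a - expo (fst (ys ! l))) (r a l)))"
      using label_matrix_mult_vec[OF z, of p "map fst xs"] p by (simp add: z_def)
    also have "\<dots> = (\<Sum>a\<in>E. \<Sum>l<length ys. Poly_Mapping.single (expo (fst (ys ! l) - ?A)) (snd (ys ! l) p) *
         Poly_Mapping.single (a - expo (fst (ys ! l))) (r a l))"
      unfolding sum_distrib_left by (rule sum.swap)
    also have "\<dots> = (\<Sum>a\<in>E. Poly_Mapping.single (a - expo ?A) (?c a p))"
    proof (intro sum.cong refl)
      fix a
      have "(\<Sum>l<length ys. Poly_Mapping.single (expo (fst (ys ! l) - ?A)) (snd (ys ! l) p) *
         Poly_Mapping.single (a - expo (fst (ys ! l))) (r a l)) =
        (\<Sum>l<length ys. Poly_Mapping.single (a - expo ?A) (r a l * snd (ys ! l) p))"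
      proof (intro sum.cong refl)
        fix l assume l: "l \<in> {..<length ys}"
        show "Poly_Mapping.single (expo (fst (ys ! l) - ?A)) (snd (ys ! l) p) *
         Poly_Mapping.single (a - expo (fst (ys ! l))) (r a l) =
         Poly_Mapping.single (a - expo ?A) (r a l * snd (ys ! l) p)"
        proof (cases "snd (ys ! l) p = 0 \<or> r a l = 0")
          case False
          then have "?A \<subseteq> fst (ys ! l)" "fst (ys ! l) \<subseteq> Poly_Mapping.keys a"
            using r[of a l] relations_support[OF generates_relations_nth[OF gen], of l p] l by blast+
          then show ?thesis by (simp only: mult_single expo_diff_add_minus) (simp only: mult.commute)
        qed auto
      qed
      also have "\<dots> = Poly_Mapping.single (a - expo ?A) (?c a p)"
        unfolding rc by (rule poly_mapping_eqI) (simp add: lookup_sum lookup_single when_def)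
      finally show "(\<Sum>l<length ys. Poly_Mapping.single (expo (fst (ys ! l) - ?A)) (snd (ys ! l) p) *
         Poly_Mapping.single (a - expo (fst (ys ! l))) (r a l)) = Poly_Mapping.single (a - expo ?A) (?c a p)" .
    qed
    also have "\<dots> = w $ p"
    proof (rule poly_mapping_eqI)
      fix b
      have sub: "?A \<subseteq> Poly_Mapping.keys (b + expo ?A)" unfolding subset_keys_iff by blast
      have "Poly_Mapping.lookup (\<Sum>a\<in>E. Poly_Mapping.single (a - expo ?A) (?c a p)) b =
        (\<Sum>a\<in>E. if a = b + expo ?A then Poly_Mapping.lookup (w $ p) b else 0)"
        unfolding lookup_sum lookup_single when_def
      proof (rule sum.cong[OF refl])
        fix a
        show "(if a - expo ?A = b then ?c a p else 0) = (if a = b + expo ?A then Poly_Mapping.lookup (w $ p) b else 0)"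
        proof (cases "?A \<subseteq> Poly_Mapping.keys a")
          case True
          then have "a - expo ?A = b \<longleftrightarrow> a = b + expo ?A" using expo_minus_add[OF True] by auto
          then show ?thesis using True p by (auto simp: multidegree_part_def)
        next
          case False
          then have "a \<noteq> b + expo ?A" using sub by auto
          then show ?thesis using False p by (simp add: multidegree_part_def)
        qed
      qed
      also have "\<dots> = (if b + expo ?A \<in> E then Poly_Mapping.lookup (w $ p) b else 0)"
        using finE by simp
      also have "\<dots> = Poly_Mapping.lookup (w $ p) b"
      proof (cases "b \<in> Poly_Mapping.keys (w $ p)")
        case True
        then have "b + expo ?A \<in> E" using p unfolding E_def by blast
        then show ?thesis by simp
      next
        case False
        then have "Poly_Mapping.lookup (w $ p) b = 0" by (simp add: in_keys_iff)
        then show ?thesis by simp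
      qed
      finally show "Poly_Mapping.lookup (\<Sum>a\<in>E. Poly_Mapping.single (a - expo ?A) (?c a p)) b = Poly_Mapping.lookup (w $ p) b" .
    qed
    finally show ?thesis .
  qed
  then have "label_matrix (map fst xs) ys *\<^sub>v z = w"
    using w(1) by (intro eq_vecI) (auto simp: label_matrix_def)
  then show "w \<in> {label_matrix (map fst xs) ys *\<^sub>v w | w. w \<in> carrier_vec (length ys)}" using z by blast
next
  fix w assume "w \<in> {label_matrix (map fst xs) ys *\<^sub>v w | w. w \<in> carrier_vec (length ys)}"
  then obtain z where z: "z \<in> carrier_vec (length ys)" "w = label_matrix (map fst xs) ys *\<^sub>v z" by blast
  have c: "label_matrix Bs xs \<in> carrier_mat (length Bs) (length xs)"
    "label_matrix (map fst xs) ys \<in> carrier_mat (length xs) (length ys)"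
    by (auto simp: label_matrix_def)
  have "label_matrix Bs xs *\<^sub>v w = label_matrix Bs xs * label_matrix (map fst xs) ys *\<^sub>v z"
    using assoc_mult_mat_vec[OF c z(1)] z(2) by simp
  also have "\<dots> = 0\<^sub>v (length Bs)"
    using z(1) unfolding label_matrix_mult_eq_0[OF sup gen] by (intro eq_vecI) auto
  finally show "w \<in> mat_kernel (label_matrix Bs xs)"
    using c z by (auto simp: mat_kernel_def)
qed

primrec syzygy_columns :: "('v::finite set \<times> (nat \<Rightarrow> 'k::field)) list \<Rightarrow> nat \<Rightarrow> ('v set \<times> (nat \<Rightarrow> 'k)) list" where
  "syzygy_columns xs 0 = xs"
| "syzygy_columns xs (Suc i) = (SOME ys. generates_relations (set ys) (syzygy_columns xs i) \<and>
     distinct ys \<and> irredundant (set ys))"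

lemma syzygy_columns_Suc:
  "generates_relations (set (syzygy_columns xs (Suc i))) (syzygy_columns xs i)"
  "distinct (syzygy_columns xs (Suc i))" "irredundant (set (syzygy_columns xs (Suc i)))"
proof -
  obtain Y where "finite Y" "generates_relations Y (syzygy_columns xs i)" "irredundant Y"
    using exists_irredundant_generating_set by blast
  then have "\<exists>ys. generates_relations (set ys) (syzygy_columns xs i) \<and> distinct ys \<and> irredundant (set ys)"
    using finite_distinct_list by metis
  from someI_ex[OF this]
  show "generates_relations (set (syzygy_columns xs (Suc i))) (syzygy_columns xs i)"
  "distinct (syzygy_columns xs (Suc i))" "irredundant (set (syzygy_columns xs (Suc i)))"
    by simp_all
qed

lemma single_expo_in_ideal_of_variables:
  assumes "F \<noteq> {}"
  shows "(Poly_Mapping.single (expo F) c :: ('v::finite, 'k::field) mpoly) \<in> ideal_generated (Set.range variable)"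
proof -
  obtain v where v: "v \<in> F" using assms by blast
  then have "expo (F - {v}) + expo {v} = expo F" by (intro expo_diff_add) auto
  then have "Poly_Mapping.single (expo F) c = Poly_Mapping.single (expo (F - {v})) c * (variable v :: ('v, 'k) mpoly)"
    by (simp add: variable_def mult_single expo_singleton)
  then show ?thesis by (simp add: ideal.span_scale ideal.span_base)
qed

lemma ideal_generated_eq_combinations:
  fixes g :: "nat \<Rightarrow> 'r::comm_ring_1"
  shows "ideal_generated (g ` {..<n}) = {\<Sum>l<n. g l * w $ l | w. w \<in> carrier_vec n}"
proof (intro subset_antisym subsetI)
  fix p assume "p \<in> ideal_generated (g ` {..<n})"
  then have "\<exists>f. p = (\<Sum>l<n. g l * f l)"
  proof (induction rule: ideal.span_induct_alt)
    case base
    then show ?case by (intro exI[of _ "\<lambda>_. 0"]) simp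
  next
    case (step c x y)
    then obtain f k where "y = (\<Sum>l<n. g l * f l)" "x = g k" "k < n" by auto
    moreover from this have "(\<Sum>l<n. g l * (if l = k then c else 0)) = g k * c"
      by (simp add: if_distrib[of "\<lambda>x. _ * x"] cong: if_cong)
    ultimately have "c * x + y = (\<Sum>l<n. g l * ((if l = k then c else 0) + f l))"
      by (simp only: distrib_left sum.distrib mult.commute)
    then show ?case by (rule exI[of _ "\<lambda>l. (if l = k then c else 0) + f l"])
  qed
  then obtain f where "p = (\<Sum>l<n. g l * f l)" by blast
  then have "p = (\<Sum>l<n. g l * vec n f $ l)" by simp
  then show "p \<in> {\<Sum>l<n. g l * w $ l | w. w \<in> carrier_vec n}" using vec_carrier by blast
next
  fix p assume "p \<in> {\<Sum>l<n. g l * w $ l | w. w \<in> carrier_vec n}"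
  then obtain w where "p = (\<Sum>l<n. g l * w $ l)" by blast
  then have p: "p = (\<Sum>l<n. w $ l * g l)" by (simp only: mult.commute)
  have "g l \<in> ideal_generated (g ` {..<n})" if "l < n" for l
    using that by (intro ideal.span_base) blast
  then show "p \<in> ideal_generated (g ` {..<n})"
    unfolding p by (intro ideal.span_sum ideal.span_scale) blast
qed

text \<open>The construction starts with one column for each generator, over the single row labelled by the
  empty set. For an antichain this is irredundant, because no other label lies below a given one.\<close>

lemma exists_minimal_resolution_squarefree:
  fixes W :: "'v::finite set set"
  assumes antichain: "\<And>A B. A \<in> W \<Longrightarrow> B \<in> W \<Longrightarrow> A \<subseteq> B \<Longrightarrow> A = B"
  shows "\<exists>D d. minimal_graded_free_resolution
    (ideal_generated (squarefree_monomial ` W) :: ('v, 'k::field) mpoly set) D d"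
proof -
  define \<epsilon> where "\<epsilon> = (\<lambda>m::nat. if m = 0 then 1 else 0 :: 'k)"
  obtain Ws where Ws: "set Ws = W" "distinct Ws" using finite_distinct_list[of W] by auto
  define xs where "xs = map (\<lambda>A. (A, \<epsilon>)) Ws"
  define stage where "stage = syzygy_columns xs"
  define rows where "rows = (\<lambda>i. case i of 0 \<Rightarrow> [{}] | Suc i \<Rightarrow> map fst (stage i))"
  define D where "D = (\<lambda>i. label_matrix (rows i) (stage i))"
  define d where "d = (\<lambda>i l. card (fst (stage i ! l)))"
  have rows: "rows 0 = [{}]" "rows (Suc i) = map fst (stage i)" for i
    by (auto simp: rows_def)
  have gen: "generates_relations (set (stage (Suc i))) (stage i)" for i
    unfolding stage_def by (rule syzygy_columns_Suc)
  have stage0: "stage 0 = xs" by (simp add: stage_def)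
  have "distinct (stage i) \<and> irredundant (set (stage i))" for i
  proof (cases i)
    case (Suc j)
    then show ?thesis using syzygy_columns_Suc[of xs j] unfolding stage_def by blast
  next
    case 0
    have "columns_below (set xs - {(A, \<epsilon>)}) A = {}" if "A \<in> W" for A
      using that antichain by (auto simp: columns_below_def xs_def Ws)
    moreover have "\<epsilon> \<noteq> 0" by (auto simp: \<epsilon>_def fun_eq_iff intro!: exI[of _ 0])
    ultimately have "irredundant (set xs)"
      by (auto simp: irredundant_def xs_def Ws column.span_empty)
    moreover have "distinct xs" using Ws by (auto simp: xs_def distinct_map inj_on_def)
    ultimately show ?thesis using 0 stage0 by simp
  qed
  then have irr: "distinct (stage i)" "irredundant (set (stage i))" for i by auto
  have sup: "supported_on (rows i) (stage i)" for i
  proof (cases i)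
    case (Suc j)
    then show ?thesis using supported_on_generates_relations[OF gen[of j]] rows by simp
  next
    case 0
    then show ?thesis by (auto simp: supported_on_def rows stage0 xs_def \<epsilon>_def)
  qed
  have dims: "dim_row (D i) = length (rows i)" "dim_col (D i) = length (stage i)" for i
    by (auto simp: D_def label_matrix_def)
  have entry: "D i $$ (m, l) = Poly_Mapping.single (expo (fst (stage i ! l) - rows i ! m)) (snd (stage i ! l) m)"
    if "m < length (rows i)" "l < length (stage i)" for i m l
    using that by (simp add: D_def label_matrix_def)
  have degree: "exponent_degree a + card (rows i ! m) = d i l"
    if ml: "m < length (rows i)" "l < length (stage i)" and a: "a \<in> Poly_Mapping.keys (D i $$ (m, l))" for i m l a
  proof -
    have a': "a = expo (fst (stage i ! l) - rows i ! m)" "snd (stage i ! l) m \<noteq> 0"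
      using a by (auto simp: entry[OF ml] split: if_splits)
    then have "rows i ! m \<subseteq> fst (stage i ! l)" using sup[of i] ml by (simp add: supported_on_def)
    then show ?thesis using a' by (simp add: d_def card_Diff_subset card_mono)
  qed
  have image: "{(D 0 *\<^sub>v w) $ 0 | w. w \<in> carrier_vec (dim_col (D 0))} =
    ideal_generated (squarefree_monomial ` W)"
  proof -
    let ?g = "\<lambda>l. squarefree_monomial (Ws ! l) :: ('v, 'k) mpoly"
    have len: "length (stage 0) = length Ws" by (simp add: stage0 xs_def)
    have D0: "(D 0 *\<^sub>v w) $ 0 = (\<Sum>l<length Ws. ?g l * w $ l)" if "w \<in> carrier_vec (length Ws)" for w
    proof -
      have "(D 0 *\<^sub>v w) $ 0 =
        (\<Sum>p<length Ws. Poly_Mapping.single (expo (fst (stage 0 ! p) - rows 0 ! 0)) (snd (stage 0 ! p) 0) * w $ p)"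
        using label_matrix_mult_vec[of w "stage 0" 0 "rows 0"] that len unfolding D_def by (simp only: rows) auto
      also have "\<dots> = (\<Sum>l<length Ws. ?g l * w $ l)"
      proof (rule sum.cong[OF refl])
        fix l assume "l \<in> {..<length Ws}"
        then have "stage 0 ! l = (Ws ! l, \<epsilon>)" by (simp add: stage0 xs_def)
        then show "Poly_Mapping.single (expo (fst (stage 0 ! l) - rows 0 ! 0)) (snd (stage 0 ! l) 0) * w $ l = ?g l * w $ l"
          by (simp add: rows \<epsilon>_def squarefree_monomial_eq)
      qed
      finally show ?thesis .
    qed
    have "{(D 0 *\<^sub>v w) $ 0 | w. w \<in> carrier_vec (dim_col (D 0))} =
      (\<lambda>w. (D 0 *\<^sub>v w) $ 0) ` carrier_vec (length Ws)"
      unfolding dims len by blast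
    also have "\<dots> = (\<lambda>w. \<Sum>l<length Ws. ?g l * w $ l) ` carrier_vec (length Ws)"
      by (rule image_cong[OF refl D0])
    also have "\<dots> = {\<Sum>l<length Ws. ?g l * w $ l | w. w \<in> carrier_vec (length Ws)}"
      by blast
    also have "\<dots> = ideal_generated (?g ` {..<length Ws})"
      by (rule ideal_generated_eq_combinations[symmetric])
    also have "?g ` {..<length Ws} = squarefree_monomial ` W"
      unfolding Ws(1)[symmetric] set_conv_nth by blast
    finally show ?thesis .
  qed
  have "graded_free_resolution (ideal_generated (squarefree_monomial ` W)) D d"
    unfolding graded_free_resolution_def
  proof (intro conjI allI impI ballI)
    show "dim_row (D 0) = 1" by (simp add: dims rows)
    show "dim_row (D (Suc i)) = dim_col (D i)" for i by (simp add: dims rows)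
    show "homogeneous (D 0 $$ (0, l)) (d 0 l)" if "l < dim_col (D 0)" for l
      using degree[of 0 0 l] that by (auto simp: homogeneous_def dims rows)
    show "exponent_degree a + d i m = d (Suc i) l"
      if "m < dim_col (D i)" "l < dim_col (D (Suc i))" "a \<in> Poly_Mapping.keys (D (Suc i) $$ (m, l))" for i m l a
      using degree[of m "Suc i" l a] that by (simp add: dims rows d_def)
    show "mat_kernel (D i) = {D (Suc i) *\<^sub>v w |w. w \<in> carrier_vec (dim_col (D (Suc i)))}" for i
      using kernel_label_matrix[OF sup gen, of i] by (simp add: D_def[symmetric] dims rows) (simp add: D_def rows)
  qed (fact image)
  moreover have "D (Suc i) $$ (m, l) \<in> ideal_generated (Set.range variable)"
    if "m < dim_col (D i)" "l < dim_col (D (Suc i))" for i m l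
  proof -
    have ml: "m < length (stage i)" "l < length (stage (Suc i))" using that by (auto simp: dims)
    let ?A = "fst (stage (Suc i) ! l)" and ?c = "snd (stage (Suc i) ! l)"
    have D: "D (Suc i) $$ (m, l) = Poly_Mapping.single (expo (?A - fst (stage i ! m))) (?c m)"
      using entry[of m "Suc i" l] ml by (simp add: rows)
    have rel: "?c \<in> relations (stage i) ?A" using generates_relations_nth[OF gen ml(2)] .
    show ?thesis
    proof (cases "?c m = 0")
      case True
      then show ?thesis by (simp add: D ideal.span_zero)
    next
      case False
      then have "fst (stage i ! m) \<subseteq> ?A" using relations_support[OF rel] by blast
      moreover have "fst (stage i ! m) \<noteq> ?A"
        using irredundant_relation_eq_0[OF irr, of ?c i m] rel ml(1) False by auto
      ultimately show ?thesis unfolding D by (intro single_expo_in_ideal_of_variables) blast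
    qed
  qed
  ultimately show ?thesis
    unfolding minimal_graded_free_resolution_def by blast
qed


section \<open>A non-linear syzygy\<close>

lemma lookup_linear_form_times:
  fixes p q :: "('v::finite, 'k::field) mpoly"
  assumes "\<And>a. a \<in> Poly_Mapping.keys p \<Longrightarrow> exponent_degree a = 1"
  shows "Poly_Mapping.lookup (p * q) (expo F) =
    (\<Sum>i\<in>F. Poly_Mapping.lookup p (expo {i}) * Poly_Mapping.lookup q (expo (F - {i})))"
proof -
  let ?s = "\<lambda>i. Poly_Mapping.single (expo {i}) (Poly_Mapping.lookup p (expo {i}))"
  have p: "p = (\<Sum>i\<in>UNIV. ?s i)"
  proof (rule poly_mapping_eqI)
    fix a
    show "Poly_Mapping.lookup p a = Poly_Mapping.lookup (\<Sum>i\<in>UNIV. ?s i) a"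
    proof (cases "\<exists>j. a = expo {j}")
      case True
      then show ?thesis by (auto simp: lookup_sum lookup_single when_def)
    next
      case False
      then have "a \<notin> Poly_Mapping.keys p"
        by (metis assms exponent_degree_1E expo_singleton)
      then show ?thesis using False
        by (auto simp: lookup_sum lookup_single when_def in_keys_iff intro!: sum.neutral[symmetric])
    qed
  qed
  have one: "Poly_Mapping.lookup (?s i * q) (expo F) =
    (if i \<in> F then Poly_Mapping.lookup p (expo {i}) * Poly_Mapping.lookup q (expo (F - {i})) else 0)" for i
  proof (cases "i \<in> F")
    case True
    then have F: "expo F = expo {i} + expo (F - {i})"
      using expo_diff_add[of "{i}" F] by (simp add: add.commute)
    show ?thesis
      unfolding F by (subst lookup_times_eq_single_term) (use True in \<open>auto split: if_splits\<close>)
  next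
    case False
    have "Poly_Mapping.lookup (?s i * q) (expo F) = 0"
    proof (rule lookup_times_eq_0)
      fix a c assume "a + c = expo F" "a \<in> Poly_Mapping.keys (?s i)"
      then have "expo F = c + expo {i}" by (auto split: if_splits simp: add.commute)
      then have "{i} \<subseteq> F" by (rule subset_of_expo_eq_add)
      then show False using False by simp
    qed
    then show ?thesis using False by simp
  qed
  have "Poly_Mapping.lookup (p * q) (expo F) = (\<Sum>i\<in>UNIV. Poly_Mapping.lookup (?s i * q) (expo F))"
    by (subst p) (simp add: sum_distrib_right lookup_sum)
  also have "\<dots> = (\<Sum>i\<in>F. Poly_Mapping.lookup p (expo {i}) * Poly_Mapping.lookup q (expo (F - {i})))"
    unfolding one by (simp add: sum.If_cases)
  finally show ?thesis .
qed

lemma zero_not_in_keys_ideal_of_variables: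
  assumes "p \<in> (ideal_generated (Set.range variable) :: ('v::finite, 'k::field) mpoly set)"
  shows "0 \<notin> Poly_Mapping.keys p"
proof
  assume zero: "0 \<in> Poly_Mapping.keys p"
  have "(0::'v \<Rightarrow>\<^sub>0 nat) \<noteq> 0"
  proof (rule keys_ideal_generated[where P = "\<lambda>a. a \<noteq> 0", OF assms _ _ zero])
    fix g :: "('v, 'k) mpoly" and a assume "g \<in> Set.range variable" "a \<in> Poly_Mapping.keys g"
    then obtain v where "a = expo {v}" by (auto simp: variable_def expo_singleton)
    then show "a \<noteq> 0" by (metis keys_expo keys_zero empty_not_insert)
  next
    fix a b :: "'v \<Rightarrow>\<^sub>0 nat" assume "a \<noteq> 0"
    then show "b + a \<noteq> 0"
      by (metis add_is_0 exponent_degree_add exponent_degree_eq_0)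
  qed
  then show False by simp
qed

lemma mult_mat_vec_index_sum:
  assumes "w \<in> carrier_vec (dim_col A)" "i < dim_row A"
  shows "(A *\<^sub>v w) $ i = (\<Sum>l<dim_col A. A $$ (i, l) * w $ l)"
  using assms by (auto simp: scalar_prod_def atLeast0LessThan intro!: sum.cong)

text \<open>
  Let \<open>g\<close> be the entries of \<open>D 0\<close>. A vector \<open>s\<close> in \<open>F\<^sub>0\<close> has, with respect to the monomial generators, the
  coefficient \<open>\<Sum>m. c\<^sub>m s\<^sub>m\<close> at \<open>x\<^sup>u\<close>, where \<open>c\<^sub>m\<close> is the coefficient of \<open>x\<^sup>u\<close> in \<open>g m\<close>. The functional
  \<open>\<Phi>\<close> below extracts from it the coefficient of \<open>x\<^sup>F\<close>. It separates two kinds of syzygies: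

  \<^item> In a linear syzygy the coefficient at \<open>x\<^sup>u\<close> is a linear form that does not involve \<open>x\<^sub>i\<close> for
    \<open>i \<in> F\<close>. Indeed, \<open>x\<^sub>i x\<^sup>u\<close> would have to cancel against a multiple of another generator dividing it, and
    there is none. Multiples of such a form do not contain \<open>x\<^sup>F\<close>, so \<open>\<Phi>\<close> vanishes on all combinations
    of linear syzygies.

  \<^item> The syzygy given by \<open>x\<^sup>F x\<^sup>u = x\<^sup>y x\<^sup>v\<close> with \<open>y = u \<union> F - v\<close> has \<open>\<Phi> = 1\<close>, since \<open>x\<^sup>y\<close> does not divide \<open>x\<^sup>F\<close>.

  Hence the first syzygies are not all linear.
\<close>

lemma minimal_resolution_nonlinear_syzygy:
  fixes W :: "'v::finite set set" and D :: "nat \<Rightarrow> ('v, 'k::field) mpoly mat"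
  assumes res: "minimal_graded_free_resolution (ideal_generated (squarefree_monomial ` W)) D d"
    and card: "\<And>w. w \<in> W \<Longrightarrow> card w = e"
    and uv: "u \<in> W" "v \<in> W" "v \<noteq> u" "v \<subseteq> u \<union> F" "F \<inter> u = {}"
    and isolated: "\<And>w i. w \<in> W \<Longrightarrow> i \<in> F \<Longrightarrow> w \<subseteq> insert i u \<Longrightarrow> w = u"
  shows "\<exists>j<dim_col (D 1). d 1 j \<noteq> e + 1"
proof (rule ccontr)
  assume "\<not> ?thesis"
  then have linear: "\<And>j. j < dim_col (D 1) \<Longrightarrow> d 1 j = e + 1" by auto
  let ?I = "ideal_generated (squarefree_monomial ` W) :: ('v, 'k) mpoly set"
  define n where "n = dim_col (D 0)"
  define S where "S = D 1"
  define g where "g = (\<lambda>l. D 0 $$ (0, l))"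
  have grad: "graded_free_resolution ?I D d"
    using res by (simp add: minimal_graded_free_resolution_def)
  note G = grad[unfolded graded_free_resolution_def]
  have rows: "dim_row (D 0) = 1" "dim_row (S) = n"
    using G[THEN conjunct1] G[THEN conjunct2, THEN conjunct1, THEN spec, of 0] by (simp_all add: n_def S_def)
  have g_hom: "homogeneous (g l) (d 0 l)" if "l < n" for l
    using G[THEN conjunct2, THEN conjunct2, THEN conjunct1] that by (simp add: g_def n_def)
  have D1_hom: "exponent_degree a + d 0 m = d 1 j"
    if "m < n" "j < dim_col S" "a \<in> Poly_Mapping.keys (S $$ (m, j))" for m j a
    using G[THEN conjunct2, THEN conjunct2, THEN conjunct2, THEN conjunct1, THEN spec, of 0] that
    by (simp add: n_def S_def)
  have image: "{(D 0 *\<^sub>v w) $ 0 | w. w \<in> carrier_vec n} = ?I"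
    unfolding n_def by (rule G[THEN conjunct2, THEN conjunct2, THEN conjunct2, THEN conjunct2, THEN conjunct1])
  have kernel: "mat_kernel (D 0) = {S *\<^sub>v w | w. w \<in> carrier_vec (dim_col S)}"
    unfolding S_def One_nat_def
    by (rule G[THEN conjunct2, THEN conjunct2, THEN conjunct2, THEN conjunct2, THEN conjunct2, THEN spec])
  have D0: "(D 0 *\<^sub>v w) $ 0 = (\<Sum>l<n. g l * w $ l)" if "w \<in> carrier_vec n" for w
    using mult_mat_vec_index_sum[of w "D 0" 0] that rows by (simp add: n_def g_def)
  have g_keys: "\<exists>w\<in>W. \<exists>c. b = c + expo w" if l: "l < n" and b: "b \<in> Poly_Mapping.keys (g l)" for l b
  proof (rule keys_ideal_generated[where P = "\<lambda>b. \<exists>w\<in>W. \<exists>c. b = c + expo w", OF _ _ _ b])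
    have "(\<Sum>l'<n. g l' * unit_vec n l $ l') = (\<Sum>l'<n. if l' = l then g l' else 0)"
      using l by (intro sum.cong) auto
    then have "g l = (D 0 *\<^sub>v unit_vec n l) $ 0"
      using l by (simp add: D0)
    then show "g l \<in> ?I" unfolding image[symmetric] using unit_vec_carrier by blast
  next
    fix h :: "('v, 'k) mpoly" and a assume "h \<in> squarefree_monomial ` W" "a \<in> Poly_Mapping.keys h"
    then show "\<exists>w\<in>W. \<exists>c. a = c + expo w"
      by (auto simp: squarefree_monomial_eq intro!: bexI exI[of _ 0])
  qed (metis add.assoc)
  have g_degree: "e \<le> exponent_degree b \<and> (exponent_degree b = e \<longrightarrow> (\<exists>w\<in>W. b = expo w))"
    if "l < n" "b \<in> Poly_Mapping.keys (g l)" for l b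
  proof -
    from g_keys[OF that] obtain w c where "w \<in> W" "b = c + expo w" by blast
    then show ?thesis using card by (auto simp: exponent_degree_add exponent_degree_eq_0)
  qed
  \<comment> \<open>Minimality excludes constant entries, hence contributions of generators of degree above \<open>e\<close>.\<close>
  have no_const: "a \<noteq> 0" if "m < n" "j < dim_col S" "a \<in> Poly_Mapping.keys (S $$ (m, j))" for m j a
  proof -
    have "S $$ (m, j) \<in> ideal_generated (Set.range variable)"
      using res that unfolding minimal_graded_free_resolution_def n_def S_def One_nat_def by blast
    then show ?thesis using that(3) zero_not_in_keys_ideal_of_variables by blast
  qed
  have degree_D1: "exponent_degree a + d 0 m = e + 1"
    if "m < n" "j < dim_col S" "a \<in> Poly_Mapping.keys (S $$ (m, j))" for m j a
    using D1_hom[OF that] linear that(2) by (simp add: S_def)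
  have relation: "(\<Sum>m<n. g m * S $$ (m, j)) = 0" if j: "j < dim_col S" for j
  proof -
    have "S *\<^sub>v unit_vec (dim_col S) j = col (S) j"
    proof (rule eq_vecI)
      show "(S *\<^sub>v unit_vec (dim_col S) j) $ i = col (S) j $ i" if "i < dim_vec (col (S) j)" for i
        using j that scalar_prod_right_unit[of j "dim_col S" "row (S) i"] by simp
    qed simp
    then have "col (S) j \<in> mat_kernel (D 0)"
      unfolding kernel using unit_vec_carrier by (metis (mono_tags, lifting) mem_Collect_eq)
    then have "col (S) j \<in> carrier_vec n" "D 0 *\<^sub>v col (S) j = 0\<^sub>v 1"
      by (simp_all add: mat_kernel_def n_def rows)
    then have "(\<Sum>m<n. g m * col (S) j $ m) = 0"
      using D0[of "col (S) j"] by simp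
    then show ?thesis using j rows by simp
  qed
  have linear_part: "(\<Sum>m<n. Poly_Mapping.lookup (g m) (expo u) * Poly_Mapping.lookup (S $$ (m, j)) (expo {i})) = 0"
    if j: "j < dim_col S" and i: "i \<in> F" for i j
  proof -
    have "Poly_Mapping.lookup (g m * S $$ (m, j)) (expo u + expo {i}) =
      Poly_Mapping.lookup (g m) (expo u) * Poly_Mapping.lookup (S $$ (m, j)) (expo {i})" if m: "m < n" for m
    proof (rule lookup_times_eq_single_term)
      fix a c assume ac: "a + c = expo u + expo {i}" "a \<in> Poly_Mapping.keys (g m)" "c \<in> Poly_Mapping.keys (S $$ (m, j))"
      have "exponent_degree a + exponent_degree c = e + 1"
        using arg_cong[OF ac(1), of exponent_degree] card[OF uv(1)] by (simp add: exponent_degree_add)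
      moreover have "exponent_degree c \<noteq> 0"
        using no_const[OF m j ac(3)] by (simp add: exponent_degree_eq_0)
      ultimately obtain w where w: "w \<in> W" "a = expo w"
        using g_degree[OF m ac(2)] by auto
      have "w \<subseteq> Poly_Mapping.keys (expo u + expo {i})"
        using ac(1) w(2) subset_keys_iff by (metis add.commute)
      then have "w \<subseteq> insert i u" using keys_add[of "expo u" "expo {i}"] by auto
      then show "a = expo u" using isolated[OF w(1) i] w(2) by simp
    qed
    then have "(\<Sum>m<n. Poly_Mapping.lookup (g m) (expo u) * Poly_Mapping.lookup (S $$ (m, j)) (expo {i})) =
      Poly_Mapping.lookup (\<Sum>m<n. g m * S $$ (m, j)) (expo u + expo {i})"
      by (simp add: lookup_sum)
    then show ?thesis by (simp add: relation[OF j])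
  qed
  define \<Phi> where "\<Phi> = (\<lambda>s. \<Sum>m<n. Poly_Mapping.lookup (g m) (expo u) * Poly_Mapping.lookup (s $ m) (expo F))"
  have \<Phi>0: "\<Phi> (S *\<^sub>v r) = 0" if r: "r \<in> carrier_vec (dim_col S)" for r
  proof -
    have "Poly_Mapping.lookup (g m) (expo u) * Poly_Mapping.lookup ((S *\<^sub>v r) $ m) (expo F) =
      (\<Sum>j<dim_col S. \<Sum>i\<in>F. Poly_Mapping.lookup (g m) (expo u) *
        Poly_Mapping.lookup (S $$ (m, j)) (expo {i}) * Poly_Mapping.lookup (r $ j) (expo (F - {i})))"
      if m: "m < n" for m
    proof (cases "expo u \<in> Poly_Mapping.keys (g m)")
      case True
      then have "d 0 m = e" using g_hom[OF m] card[OF uv(1)] by (auto simp: homogeneous_def)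
      then have lin: "\<And>j a. j < dim_col S \<Longrightarrow> a \<in> Poly_Mapping.keys (S $$ (m, j)) \<Longrightarrow> exponent_degree a = 1"
        using degree_D1[OF m] by fastforce
      have eq: "(S *\<^sub>v r) $ m = (\<Sum>j<dim_col S. S $$ (m, j) * r $ j)"
        using mult_mat_vec_index_sum[OF r, of m] m rows by simp
      have sum: "Poly_Mapping.lookup ((S *\<^sub>v r) $ m) (expo F) =
        (\<Sum>j<dim_col S. \<Sum>i\<in>F. Poly_Mapping.lookup (S $$ (m, j)) (expo {i}) * Poly_Mapping.lookup (r $ j) (expo (F - {i})))"
        unfolding eq lookup_sum
      proof (intro sum.cong refl)
        fix j assume "j \<in> {..<dim_col S}"
        then show "Poly_Mapping.lookup (S $$ (m, j) * r $ j) (expo F) =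
          (\<Sum>i\<in>F. Poly_Mapping.lookup (S $$ (m, j)) (expo {i}) * Poly_Mapping.lookup (r $ j) (expo (F - {i})))"
          using lin by (intro lookup_linear_form_times) auto
      qed
      show ?thesis unfolding sum sum_distrib_left by (simp only: mult.assoc)
    next
      case False
      then show ?thesis by (simp add: in_keys_iff)
    qed
    then have "\<Phi> (S *\<^sub>v r) = (\<Sum>m<n. \<Sum>j<dim_col S. \<Sum>i\<in>F. Poly_Mapping.lookup (g m) (expo u) *
        Poly_Mapping.lookup (S $$ (m, j)) (expo {i}) * Poly_Mapping.lookup (r $ j) (expo (F - {i})))"
      by (simp add: \<Phi>_def)
    also have "\<dots> = (\<Sum>j<dim_col S. \<Sum>i\<in>F. \<Sum>m<n. Poly_Mapping.lookup (g m) (expo u) *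
        Poly_Mapping.lookup (S $$ (m, j)) (expo {i}) * Poly_Mapping.lookup (r $ j) (expo (F - {i})))"
      by (subst sum.swap, rule sum.cong[OF refl], rule sum.swap)
    also have "\<dots> = 0"
      unfolding sum_distrib_right[symmetric] using linear_part by simp
    finally show ?thesis .
  qed
  have ex: "\<exists>w\<in>carrier_vec n. (\<Sum>l<n. g l * w $ l) = Poly_Mapping.single (expo x) 1" if "x \<in> W" for x
  proof -
    have "Poly_Mapping.single (expo x) 1 \<in> ?I"
      using that by (auto simp flip: squarefree_monomial_eq intro!: ideal.span_base)
    then obtain w where "w \<in> carrier_vec n" "(D 0 *\<^sub>v w) $ 0 = Poly_Mapping.single (expo x) 1"
      unfolding image[symmetric] by (auto simp del: index_mult_mat_vec)
    then show ?thesis using D0[of w] by auto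
  qed
  obtain P where P: "(\<Sum>l<n. g l * P $ l) = Poly_Mapping.single (expo u) 1"
    using ex[OF uv(1)] by blast
  obtain Q where Q: "(\<Sum>l<n. g l * Q $ l) = Poly_Mapping.single (expo v) 1"
    using ex[OF uv(2)] by blast
  define y where "y = (Poly_Mapping.single (expo F) 1 :: ('v, 'k) mpoly)"
  define z where "z = (Poly_Mapping.single (expo (u \<union> F - v)) 1 :: ('v, 'k) mpoly)"
  define s where "s = vec n (\<lambda>l. P $ l * y - Q $ l * z)"
  have "s \<in> mat_kernel (D 0)"
  proof -
    have s: "s \<in> carrier_vec n" unfolding s_def by (rule vec_carrier)
    have "(D 0 *\<^sub>v s) $ 0 = (\<Sum>l<n. g l * P $ l * y - g l * Q $ l * z)"
      unfolding D0[OF s]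
    proof (rule sum.cong[OF refl])
      fix l assume "l \<in> {..<n}"
      then have "s $ l = P $ l * y - Q $ l * z"
        unfolding s_def by (intro index_vec) (rule lessThan_iff[THEN iffD1])
      then show "g l * s $ l = g l * P $ l * y - g l * Q $ l * z"
        by (simp only: right_diff_distrib mult.assoc)
    qed
    also have "\<dots> = (\<Sum>l<n. g l * P $ l) * y - (\<Sum>l<n. g l * Q $ l) * z"
      unfolding sum_subtractf sum_distrib_right ..
    also have "\<dots> = Poly_Mapping.single (expo u + expo F) 1 - Poly_Mapping.single (expo v + expo (u \<union> F - v)) 1"
      unfolding P Q y_def z_def mult_single by simp
    also have "expo u + expo F = expo (u \<union> F)"
      using uv(5) by (subst expo_union_disjoint) auto
    also have "expo v + expo (u \<union> F - v) = expo (u \<union> F)"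
      using expo_diff_add[OF uv(4)] by (simp add: add.commute)
    finally have "(D 0 *\<^sub>v s) $ 0 = 0" by simp
    then have "D 0 *\<^sub>v s = 0\<^sub>v 1" using rows by (intro eq_vecI) auto
    then show ?thesis using s by (simp add: mat_kernel_def rows n_def)
  qed
  then have "\<Phi> s = 0" using \<Phi>0 unfolding kernel by auto
  moreover have "\<Phi> s = 1"
  proof -
    \<comment> \<open>\<open>u\<close> and \<open>v\<close> have the same size\<close>
    have nsub: "\<not> u \<subseteq> v"
      using uv(1-3) card card_subset_eq[of v u] by auto
    have Qz: "Poly_Mapping.lookup (Q $ l * z) (expo F) = 0" for l
    proof (rule lookup_times_eq_0)
      fix a c assume "a + c = expo F" "c \<in> Poly_Mapping.keys z"
      then have "expo F = a + expo (u \<union> F - v)" by (simp add: z_def)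
      then have "u \<union> F - v \<subseteq> F" by (rule subset_of_expo_eq_add)
      then show False using nsub uv(5) by blast
    qed
    have Py: "Poly_Mapping.lookup (P $ l * y) (expo F) = Poly_Mapping.lookup (P $ l) 0" for l
      using lookup_times_eq_single_term[of 0 "expo F" "P $ l" y] by (simp add: y_def)
    have "Poly_Mapping.lookup (g l * P $ l) (expo u) = Poly_Mapping.lookup (g l) (expo u) * Poly_Mapping.lookup (P $ l) 0"
      if l: "l < n" for l
    proof (rule lookup_times_eq_single_term[of "expo u" 0, simplified])
      fix a c assume ac: "a + c = expo u" "a \<in> Poly_Mapping.keys (g l)"
      have "exponent_degree a + exponent_degree c = e"
        using arg_cong[OF ac(1), of exponent_degree] card[OF uv(1)] by (simp add: exponent_degree_add)
      then have "exponent_degree c = 0" using g_degree[OF l ac(2)] by auto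
      then show "a = expo u" using ac(1) by (simp add: exponent_degree_eq_0)
    qed
    then have "\<Phi> s = Poly_Mapping.lookup (\<Sum>l<n. g l * P $ l) (expo u)"
      by (simp add: \<Phi>_def s_def lookup_minus Py Qz lookup_sum)
    then show ?thesis by (simp add: P)
  qed
  ultimately show False by simp
qed


section \<open>Linearly related squarefree powers\<close>

text \<open>The degree is the least degree of a non-zero element, whatever the generators are.\<close>

lemma generated_in_degree_unique:
  fixes I :: "('v::finite, 'k::field) mpoly set"
  assumes "generated_in_degree I e" "generated_in_degree I e'" "p \<in> I" "p \<noteq> 0"
  shows "e = e'"
proof -
  have "e \<le> e'" if gen: "generated_in_degree I e" "generated_in_degree I e'" for e e'
  proof -
    obtain G G' where G: "\<And>g. g \<in> G \<Longrightarrow> homogeneous g e" "I = ideal_generated G"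
      and G': "\<And>g. g \<in> G' \<Longrightarrow> homogeneous g e'" "I = ideal_generated G'"
      using gen unfolding generated_in_degree_def by metis
    have "Poly_Mapping.keys p \<noteq> {}" using assms(4) by (auto simp: poly_mapping_eq_iff fun_eq_iff in_keys_iff)
    then obtain a where a: "a \<in> Poly_Mapping.keys p" by blast
    have "\<exists>g\<in>G'. \<exists>b. b \<in> Poly_Mapping.keys g"
      by (rule keys_ideal_generated[OF _ _ _ a, of G' "\<lambda>_. \<exists>g\<in>G'. \<exists>b. b \<in> Poly_Mapping.keys g"])
        (use assms(3) G'(2) in blast)+
    then obtain g b where g: "g \<in> G'" "b \<in> Poly_Mapping.keys g" by blast
    then have "g \<in> ideal_generated G" using G(2) G'(2) by (metis ideal.span_base)
    then have "e \<le> exponent_degree b"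
    proof (rule keys_ideal_generated[OF _ _ _ g(2), where P = "\<lambda>b. e \<le> exponent_degree b"])
      show "e \<le> exponent_degree a" if "h \<in> G" "a \<in> Poly_Mapping.keys h" for h a
        using G(1)[OF that(1)] that(2) by (simp add: homogeneous_def)
    qed (simp add: exponent_degree_add)
    then show ?thesis using G'(1)[OF g(1)] g(2) by (simp add: homogeneous_def)
  qed
  then show ?thesis using assms(1,2) by (meson le_antisym)
qed

lemma generated_in_degree_squarefree:
  assumes "\<And>w. w \<in> W \<Longrightarrow> card w = e"
  shows "generated_in_degree (ideal_generated (squarefree_monomial ` W)) e"
  unfolding generated_in_degree_def
  using assms by (intro exI[of _ "squarefree_monomial ` W"]) (auto simp: homogeneous_def squarefree_monomial_eq)

lemma has_linear_resolution_imp_linearly_related: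
  "has_linear_resolution I \<Longrightarrow> linearly_related I"
  unfolding has_linear_resolution_def linearly_related_def by (auto simp: add.commute[of 1])

text \<open>The graded Betti numbers are read off from a chosen minimal resolution. Its existence is what allows
  the argument about syzygies, which holds for every minimal resolution, to be applied to it.\<close>

lemma not_linearly_related_of_isolated_generator:
  fixes W :: "'v::finite set set"
  assumes card: "\<And>w. w \<in> W \<Longrightarrow> card w = e"
    and uv: "u \<in> W" "v \<in> W" "v \<noteq> u" "v \<subseteq> u \<union> F" "F \<inter> u = {}"
    and isolated: "\<And>w i. w \<in> W \<Longrightarrow> i \<in> F \<Longrightarrow> w \<subseteq> insert i u \<Longrightarrow> w = u"
  shows "\<not> linearly_related (ideal_generated (squarefree_monomial ` W) :: ('v, 'k::field) mpoly set)"
proof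
  let ?I = "ideal_generated (squarefree_monomial ` W) :: ('v, 'k) mpoly set"
  assume "linearly_related ?I"
  then obtain e' where e': "generated_in_degree ?I e'" "\<And>j. j \<noteq> e' + 1 \<Longrightarrow> graded_betti ?I 1 j = 0"
    by (auto simp: linearly_related_def)
  have "squarefree_monomial u \<in> ?I" using uv(1) by (intro ideal.span_base) auto
  moreover have "squarefree_monomial u \<noteq> (0 :: ('v, 'k) mpoly)"
    by (metis keys_single keys_zero empty_not_insert squarefree_monomial_eq zero_neq_one)
  ultimately have "e' = e"
    using generated_in_degree_unique[OF e'(1) generated_in_degree_squarefree] card by blast
  have "A = B" if "A \<in> W" "B \<in> W" "A \<subseteq> B" for A B
    using that card card_subset_eq[of B A] by simp
  then obtain D0 d0 where "minimal_graded_free_resolution ?I D0 d0"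
    using exists_minimal_resolution_squarefree[of W, where 'k = 'k] by blast
  then have ex: "\<exists>x. case x of (D, d) \<Rightarrow> minimal_graded_free_resolution ?I D d"
    by auto
  obtain D d where Dd: "the_minimal_resolution ?I = (D, d)" by fastforce
  then have res: "minimal_graded_free_resolution ?I D d"
    using someI_ex[OF ex] by (simp add: the_minimal_resolution_def)
  have "\<exists>l<dim_col (D 1). d 1 l \<noteq> e + 1"
    by (rule minimal_resolution_nonlinear_syzygy[OF res _ uv]) (fact card, fact isolated)
  then obtain l where l: "l < dim_col (D 1)" "d 1 l \<noteq> e + 1" by blast
  let ?L = "{l'. l' < dim_col (D 1) \<and> d 1 l' = d 1 l}"
  have "finite ?L" by (rule finite_subset[of _ "{..<dim_col (D 1)}"]) auto
  moreover have "?L \<noteq> {}" using l(1) by blast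
  ultimately have "card ?L \<noteq> 0" by (simp only: card_0_eq not_False_eq_True)
  moreover have "graded_betti ?I 1 (d 1 l) = card ?L"
    unfolding graded_betti_def Dd by (simp only: prod.case)
  moreover have "graded_betti ?I 1 (d 1 l) = 0"
    using l(2) \<open>e' = e\<close> by (intro e'(2)) simp
  ultimately show False by (simp only:)
qed

lemma matching_subset:
  assumes "N \<subseteq> M" "matching \<Delta> M"
  shows "matching \<Delta> N"
  unfolding matching_def
proof
  show "N \<subseteq> facets \<Delta>" using assms by (auto simp: matching_def)
  have "disjoint M" using assms(2) by (simp add: matching_def)
  then show "disjoint N" using assms(1) by (rule pairwise_subset)
qed

text \<open>Removing facets other than the distinguished one keeps a matching restricted, so every smaller
  positive size is attained.\<close>

lemma exists_restricted_matching_of_card: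
  assumes "F \<in> facets \<Delta>" "k < \<nu>\<^sub>0 \<Delta>"
  obtains M F where "matching \<Delta> M" "F \<in> M" "card M = Suc k" "\<And>G. G \<in> M - {F} \<Longrightarrow> forms_gap \<Delta> F G"
proof -
  let ?S = "{card M | M. restricted_matching \<Delta> M}"
  have "restricted_matching \<Delta> {F}"
    using assms(1) by (auto simp: restricted_matching_def matching_def disjoint_def)
  then have "?S \<noteq> {}" by blast
  moreover have "?S = card ` {M. restricted_matching \<Delta> M}" by blast
  then have "finite ?S" by (simp only: finite_imageI finite)
  ultimately have "\<nu>\<^sub>0 \<Delta> \<in> ?S" unfolding restricted_matching_number_def by (rule Max_in[rotated])
  then obtain M where M: "restricted_matching \<Delta> M" "card M = \<nu>\<^sub>0 \<Delta>" by auto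
  then obtain F where F: "F \<in> M" "\<And>G. G \<in> M - {F} \<Longrightarrow> forms_gap \<Delta> F G"
    unfolding restricted_matching_def by blast
  have "k \<le> card (M - {F})" using M(2) F(1) assms(2) by simp
  then obtain N where N: "N \<subseteq> M - {F}" "card N = k" by (rule obtain_subset_with_card_n)
  have "insert F N \<subseteq> M" using F(1) N(1) by blast
  moreover have "matching \<Delta> M" using M(1) by (simp add: restricted_matching_def)
  ultimately have "matching \<Delta> (insert F N)" by (rule matching_subset)
  moreover have "card (insert F N) = Suc k"
  proof -
    have "F \<notin> N" using N(1) by blast
    then have "card (insert F N) = Suc (card N)" by (rule card_insert_disjoint[OF finite])
    then show ?thesis unfolding N(2) .
  qed
  moreover have "forms_gap \<Delta> F G" if "G \<in> insert F N - {F}" for G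
    using F(2) that N(1) by blast
  ultimately show ?thesis by (intro that[of "insert F N" F]) simp_all
qed

lemma pure_facets_card:
  fixes \<Delta> :: "'v::finite set set"
  assumes "simplicial_complex \<Delta>" "pure \<Delta>" "complex_dim \<Delta> > 0"
  obtains d F where "\<And>F. F \<in> facets \<Delta> \<Longrightarrow> card F = d" "d \<ge> 2" "F \<in> facets \<Delta>"
proof -
  have "face_dim ` \<Delta> \<noteq> {}" using assms(1) unfolding simplicial_complex_def by blast
  then have "complex_dim \<Delta> \<in> face_dim ` \<Delta>"
    unfolding complex_dim_def by (rule Max_in[rotated]) (rule finite_imageI[OF finite])
  then obtain X where X: "X \<in> \<Delta>" "complex_dim \<Delta> = face_dim X" by blast
  from X(1) obtain F where F: "F \<in> facets \<Delta>" "X \<subseteq> F" by (rule face_subset_facet)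
  have "2 \<le> card X" using X(2) assms(3) by (simp add: face_dim_def)
  also have "card X \<le> card F" using F(2) by (simp add: card_mono)
  finally have "2 \<le> card F" .
  moreover have "card G = card F" if "G \<in> facets \<Delta>" for G
  proof -
    have "face_dim G = face_dim F" using assms(2) that F(1) unfolding pure_def by blast
    then show ?thesis by (simp add: face_dim_def)
  qed
  ultimately show ?thesis using that[of "card F" F] F(1) by blast
qed

theorem theorem3p3:
  fixes \<Delta> :: "'v::finite set set"
    and I :: "('v, 'k::field) mpoly set"
    and k :: nat
  assumes "simplicial_forest \<Delta>"
    and "pure \<Delta>"
    and "complex_dim \<Delta> > 0"
    and "I = facet_ideal \<Delta>"
    and "1 \<le> k" and "k < \<nu>\<^sub>0 \<Delta>"
  shows "(\<exists>e. generated_in_degree (squarefree_power I k) e)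
       \<and> \<not> linearly_related (squarefree_power I k)
       \<and> \<not> has_linear_resolution (squarefree_power I k)"
proof -
  obtain d F0 where d: "\<And>F. F \<in> facets \<Delta> \<Longrightarrow> card F = d" "d \<ge> 2" and F0: "F0 \<in> facets \<Delta>"
  proof -
    have "simplicial_complex \<Delta>" using assms(1) by (simp only: simplicial_forest_def)
    then show thesis using assms(2,3) that by (rule pure_facets_card)
  qed
  define W where "W = matching_unions \<Delta> k"
  have I: "squarefree_power I k = ideal_generated (squarefree_monomial ` W)"
    using squarefree_power_facet_ideal[OF d(1)] d(2) by (simp add: assms(4) W_def)
  have cardW: "card w = k * d" if "w \<in> W" for w
    using that card_Union_matching[OF _ d(1)] by (auto simp: W_def matching_unions_def)
  obtain M F where M: "matching \<Delta> M" "F \<in> M" "card M = Suc k"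
    and gap: "\<And>G. G \<in> M - {F} \<Longrightarrow> forms_gap \<Delta> F G"
    using exists_restricted_matching_of_card[OF F0 assms(6)] by blast
  have F: "F \<in> facets \<Delta>" using M(1,2) by (auto simp: matching_def)
  have cardMF: "card (M - {F}) = k" using M(2,3) by simp
  then have ne: "M - {F} \<noteq> {}" using assms(5) by (metis card.empty not_one_le_zero)
  then obtain G where G: "G \<in> M - {F}" by blast
  let ?u = "\<Union>(M - {F})" and ?v = "\<Union>(M - {G})"
  have "F \<inter> H = {}" if "H \<in> M - {F}" for H
    using M(1,2) that disjointD[of M F H] unfolding matching_def by blast
  then have Fu: "F \<inter> ?u = {}" by blast
  have unionW: "\<Union>N \<in> W" if "N \<subseteq> M" "card N = k" for N
    unfolding W_def matching_unions_def using matching_subset[OF that(1) M(1)] that(2) by blast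
  have uW: "?u \<in> W" by (rule unionW[OF Diff_subset cardMF])
  have "card (M - {G}) = k" using G M(3) by simp
  then have vW: "?v \<in> W" by (rule unionW[OF Diff_subset])
  have "F \<noteq> {}" using d(1)[OF F] d(2) by auto
  moreover have "F \<subseteq> ?v" using M(2) G by blast
  ultimately have vu: "?v \<noteq> ?u" using Fu by blast
  have v_sub: "?v \<subseteq> ?u \<union> F" by blast
  have isolated: "w = ?u" if w: "w \<in> W" "i \<in> F" "w \<subseteq> insert i ?u" for w i
  proof -
    obtain N where N: "matching \<Delta> N" "card N = k" "w = \<Union>N"
      using w(1) unfolding W_def matching_unions_def by blast
    have MN: "card M = Suc (card N)" by (simp only: M(3) N(2))
    have "\<Union>N \<subseteq> \<Union>M" using N(3) w(2,3) M(2) by blast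
    from matching_in_restricted_matching[OF assms(1) M(1,2) gap N(1) MN this ne]
    have "F \<in> N \<or> N = M - {F}" .
    then show ?thesis
    proof
      assume "F \<in> N"
      then have "F \<subseteq> {i}" using N(3) w(3) Fu by blast
      then have "card F \<le> 1" using card_mono[of "{i}" F] by simp
      then show ?thesis using d(1)[OF F] d(2) by simp
    next
      assume "N = M - {F}"
      then show ?thesis by (simp only: N(3))
    qed
  qed
  have "\<not> linearly_related (squarefree_power I k)"
    unfolding I
    by (rule not_linearly_related_of_isolated_generator[OF _ uW vW vu v_sub Fu]) (fact cardW, fact isolated)
  moreover have "\<exists>e. generated_in_degree (squarefree_power I k) e"
    unfolding I using generated_in_degree_squarefree cardW by blast
  ultimately show ?thesis
    using has_linear_resolution_imp_linearly_related by blast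
qed

end
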